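(* For each fixed positive integer $k$, as $n\to\infty$, $$|(\mathrm{apex}^k\,\mathcal{F})_n| \sim c_k\, 2^{kn}\, |\mathcal{F}_n|, \qquad\text{where}\quad c_k=\left(2^{\binom{k+1}{2}}\, e^{k}\, k!\right)^{-1}.$$
   Context: Graphs are finite and simple. A set $B$ of vertices of a graph $G$ is a blocker if the graph $G-B$ obtained by deleting the vertices in $B$ has no cycles. $\mathcal{F}$ denotes the class of forests, and $\mathrm{apex}^k\,\mathcal{F}$ denotes the class of graphs with a blocker of size at most $k$. For a class $\mathcal{A}$ of graphs, $\mathcal{A}_n$ denotes the set of graphs in $\mathcal{A}$ on the vertex set $\{1,\ldots,n\}$ (labelled graphs). $a_n\sim b_n$ means $a_n/b_n\to1$. *)

theory Defs
  imports
    Complex_Main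
    "HOL-Library.Landau_Symbols"
    "Graph_Theory.Digraph_Component"
begin

text \<open>
  A finite simple graph is a \<^locale>\<open>pair_graph\<close>: a finite vertex set together with a finite,
  irreflexive and symmetric set of ordered pairs. As the arcs are the pairs themselves, distinct
  values of type \<^typ>\<open>'a pair_pre_digraph\<close> satisfying \<^locale>\<open>pair_graph\<close> are distinct
  labelled graphs.

  In a symmetric digraph the arcs \<open>(u, v)\<close> and \<open>(v, u)\<close> already form a directed cycle of length two,
  so \<^const>\<open>forest\<close> from the library does not describe the undirected notion. In a loop-free
  symmetric digraph without parallel arcs, the cycles of the underlying undirected graph are
  exactly the directed cycles of length at least three.
\<close>

definition has_no_cycles :: "('a, 'b) pre_digraph \<Rightarrow> bool" where
  "has_no_cycles G \<longleftrightarrow> \<not> (\<exists>p. pre_digraph.cycle G p \<and> 3 \<le> length p)"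

definition delete_verts :: "('a, 'b) pre_digraph \<Rightarrow> 'a set \<Rightarrow> ('a, 'b) pre_digraph" where
  "delete_verts G B = G \<restriction> (verts G - B)"

definition blocker :: "('a, 'b) pre_digraph \<Rightarrow> 'a set \<Rightarrow> bool" where
  "blocker G B \<longleftrightarrow> B \<subseteq> verts G \<and> has_no_cycles (delete_verts G B)"

definition forests :: "'a pair_pre_digraph set" where
  "forests = {G. pair_graph G \<and> has_no_cycles (with_proj G)}"

definition apex_forests :: "nat \<Rightarrow> 'a pair_pre_digraph set" where
  "apex_forests k = {G. pair_graph G \<and> (\<exists>B. blocker (with_proj G) B \<and> card B \<le> k)}"

definition labelled :: "nat pair_pre_digraph set \<Rightarrow> nat \<Rightarrow> nat pair_pre_digraph set" where
  "labelled A n = {G \<in> A. pverts G = {1..n}}"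

lemma apex_forests_0: "apex_forests 0 = forests"
proof -
  have "blocker (with_proj G) {} \<longleftrightarrow> has_no_cycles (with_proj G)" if "pair_graph G"
    for G :: "'a pair_pre_digraph"
  proof -
    interpret pair_graph G by fact
    have "delete_verts (with_proj G) {} = with_proj G"
      by (auto simp: delete_verts_def induce_subgraph_def with_proj_def in_arcsD1 in_arcsD2)
    then show ?thesis by (simp add: blocker_def)
  qed
  moreover have "B = {}" if "pair_graph G" "blocker (with_proj G) B" "card B = 0"
    for G :: "'a pair_pre_digraph" and B
  proof -
    interpret pair_graph G by fact
    show ?thesis using that pair_finite_verts by (auto simp: blocker_def dest: finite_subset)
  qed
  ultimately show ?thesis
    unfolding apex_forests_def forests_def by (auto, metis card.empty)
qed

lemma finite_labelled_apex_forests: "finite (labelled (apex_forests k) n)"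
proof (rule finite_subset)
  show "labelled (apex_forests k) n \<subseteq>
      (\<lambda>E. \<lparr>pverts = {1..n}, parcs = E\<rparr>) ` Pow ({1..n} \<times> {1..n})"
  proof
    fix G :: "nat pair_pre_digraph" assume G: "G \<in> labelled (apex_forests k) n"
    then interpret pair_graph G by (simp add: labelled_def apex_forests_def)
    have "parcs G \<subseteq> {1..n} \<times> {1..n}"
      using G in_arcsD1 in_arcsD2 by (auto simp: labelled_def)
    moreover have "G = \<lparr>pverts = {1..n}, parcs = parcs G\<rparr>"
      using G by (cases G) (simp add: labelled_def)
    ultimately show "G \<in> (\<lambda>E. \<lparr>pverts = {1..n}, parcs = E\<rparr>) ` Pow ({1..n} \<times> {1..n})"
      by blast
  qed
qed simp

end

theory Submission
  imports
    Defs
    "HOL-Analysis.Uniform_Limit"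
    "HOL-Computational_Algebra.Formal_Laurent_Series"
    "HOL-Real_Asymp.Real_Asymp"
begin

text \<open>
  Counting forests: a nonempty forest has a vertex of degree at most one, so inclusion-exclusion
  over the set of these vertices yields a recursion for the number \<open>f n\<close> of labelled forests. In
  terms of the exponential generating function \<open>F\<close> it says \<open>F (w exp (-w)) = exp (w - w^2 / 2)\<close>;
  inverting it gives \<open>f n / n! = [w^n] (1 - w) exp ((n + 1) w) exp (- w^2 / 2)\<close>, and from this
  explicit sum one reads off \<open>f n ~ exp (- 1 / 2) (n + 1)^(n - 2)\<close> and \<open>n f (n - 1) / f n \<longlonglongrightarrow> 1 / e\<close>.

  Counting apex forests: the pairs of a graph and a blocker \<open>S\<close> of size \<open>k\<close> in it are counted
  exactly. Almost all forests on the complement of \<open>S\<close> contain a large matching, and a vertex of \<open>S\<close>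
  with random neighbours then forms triangles with many matching edges, so that no other set of
  \<open>k\<close> vertices is a blocker. Hence the graphs are asymptotically as many as the pairs.
\<close>

section \<open>Forests as edge sets\<close>

text \<open>Two growth rates carry the argument. The number of forests grows faster than every
  exponential, whereas the graphs with a vertex cover of bounded size are only exponentially many. A
  matching of any fixed size is therefore available in almost all forests, and a fixed size is
  enough: among the choices of edges at a vertex of \<open>S\<close>, only a fraction (3/4)^r closes
  no triangle with any of \<open>r\<close> given matching edges. Accordingly \<open>r\<close> is
  chosen from the tolerance first, and \<open>n\<close> grows afterwards. The constant arises as
  follows. Choosing \<open>S\<close> and a forest outside it gives binomial(n, k) f(n - k)
  possibilities, asymptotically exp(-k) f(n) / k!. The k (n - k) + binomial(k, 2) vertex pairs
  meeting \<open>S\<close> are free, and this exponent of two falls short of k n by exactly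
  binomial(k + 1, 2).\<close>

definition pairs :: "'a set \<Rightarrow> 'a set set" where
  "pairs V = {e. e \<subseteq> V \<and> card e = 2}"

definition nbrs :: "'a set set \<Rightarrow> 'a set \<Rightarrow> 'a \<Rightarrow> 'a set" where
  "nbrs E X v = {u \<in> X. u \<noteq> v \<and> {u, v} \<in> E}"

text \<open>
  On a finite vertex set this is acyclicity (\<open>has_no_cycles_iff_acyc\<close> below), in a form that is
  stable under removing a vertex of degree at most one.
\<close>

definition acyc :: "'a set \<Rightarrow> 'a set set \<Rightarrow> bool" where
  "acyc W E \<longleftrightarrow> (\<forall>X\<subseteq>W. X \<noteq> {} \<longrightarrow> (\<exists>v\<in>X. card (nbrs E X v) \<le> 1))"

definition forest_on :: "'a set \<Rightarrow> 'a set set set" where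
  "forest_on V = {E. E \<subseteq> pairs V \<and> acyc V E}"

definition pendant_forests :: "'a set \<Rightarrow> 'a set \<Rightarrow> 'a set set set" where
  "pendant_forests U S = {E \<in> forest_on (U \<union> S). \<forall>s\<in>S. card (nbrs E (U \<union> S) s) \<le> 1}"

lemma finite_pairs [simp]: "finite V \<Longrightarrow> finite (pairs V)"
  by (simp add: pairs_def)

lemma pairs_mono: "U \<subseteq> V \<Longrightarrow> pairs U \<subseteq> pairs V"
  by (auto simp: pairs_def)

lemma doubleton_in_pairs [simp]: "{u, v} \<in> pairs V \<longleftrightarrow> u \<in> V \<and> v \<in> V \<and> u \<noteq> v"
  by (auto simp: pairs_def)

lemma pairs_cases:
  assumes "e \<in> pairs V" obtains u v where "u \<in> V" "v \<in> V" "u \<noteq> v" "e = {u, v}"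
  using assms by (auto simp: pairs_def card_2_iff)

lemma finite_forest_on [simp]: "finite V \<Longrightarrow> finite (forest_on V)"
  unfolding forest_on_def by (rule finite_subset[of _ "Pow (pairs V)"]) auto

lemma finite_pendant_forests [simp]: "finite U \<Longrightarrow> finite S \<Longrightarrow> finite (pendant_forests U S)"
  by (simp add: pendant_forests_def)

lemma finite_nbrs [simp]: "finite X \<Longrightarrow> finite (nbrs E X v)"
  by (simp add: nbrs_def)

lemma nbrs_mono: "X \<subseteq> Y \<Longrightarrow> nbrs E X v \<subseteq> nbrs E Y v"
  by (auto simp: nbrs_def)

lemma nbrs_Int_pairs: "X \<subseteq> W \<Longrightarrow> v \<in> X \<Longrightarrow> nbrs (E \<inter> pairs W) X v = nbrs E X v"
  by (auto simp: nbrs_def)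

lemma acyc_Int_pairs: "acyc W (E \<inter> pairs W) \<longleftrightarrow> acyc W E"
  by (simp add: acyc_def nbrs_Int_pairs cong: conj_cong)

lemma acyc_subset: "acyc W E \<Longrightarrow> U \<subseteq> W \<Longrightarrow> acyc U E"
  by (auto simp: acyc_def)

section \<open>Attaching vertices of degree at most one\<close>

text \<open>In a set \<open>X\<close> containing \<open>v\<close>, the vertex \<open>v\<close>
  itself is a witness, because its degree can only shrink inside \<open>X\<close>.\<close>

lemma acyc_insert_pendant:
  assumes "finite W" "card (nbrs E (insert v W) v) \<le> 1"
  shows "acyc (insert v W) E \<longleftrightarrow> acyc W E"
proof
  assume *: "acyc W E"
  show "acyc (insert v W) E"
    unfolding acyc_def
  proof (intro allI impI)
    fix X assume X: "X \<subseteq> insert v W" "X \<noteq> {}"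
    show "\<exists>x\<in>X. card (nbrs E X x) \<le> 1"
    proof (cases "v \<in> X")
      case True
      have "card (nbrs E X v) \<le> card (nbrs E (insert v W) v)"
        using X assms(1) by (intro card_mono nbrs_mono) auto
      with assms(2) True show ?thesis by (intro bexI[of _ v]) auto
    qed (use X * in \<open>auto simp: acyc_def\<close>)
  qed
qed (auto elim: acyc_subset)

context
  fixes U S :: "'a set" and v :: 'a
  assumes fin: "finite U" "finite S" and v: "v \<notin> U" "v \<notin> S" and disj: "U \<inter> S = {}"
begin

lemma pendant_forests_isolated:
  "{E \<in> pendant_forests U (insert v S). nbrs E (U \<union> insert v S) v = {}} = pendant_forests U S"
  (is "?L = _")
proof (intro set_eqI iffI)
  fix E assume E: "E \<in> ?L"
  have E1: "E \<subseteq> pairs (U \<union> S)"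
  proof
    fix e assume e: "e \<in> E"
    then have "e \<in> pairs (U \<union> insert v S)"
      using E by (auto simp: pendant_forests_def forest_on_def)
    then obtain a b where ab: "e = {a, b}" "a \<in> U \<union> insert v S" "b \<in> U \<union> insert v S" "a \<noteq> b"
      by (elim pairs_cases)
    with e E v have "a \<noteq> v" "b \<noteq> v"
      by (auto simp: nbrs_def insert_commute)
    with ab show "e \<in> pairs (U \<union> S)" by auto
  qed
  then have "nbrs E (U \<union> insert v S) x = nbrs E (U \<union> S) x" if "x \<in> S" for x
    using v by (auto simp: nbrs_def)
  with E E1 show "E \<in> pendant_forests U S"
    by (auto simp: pendant_forests_def forest_on_def elim: acyc_subset)
next
  fix E assume E: "E \<in> pendant_forests U S"
  then have E1: "E \<subseteq> pairs (U \<union> S)" by (auto simp: pendant_forests_def forest_on_def)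
  then have n: "nbrs E (U \<union> insert v S) x = nbrs E (U \<union> S) x" if "x \<in> S" for x
    using v by (auto simp: nbrs_def)
  have n': "nbrs E (insert v (U \<union> S)) v = {}"
    using E1 v by (auto simp: nbrs_def)
  then have "acyc (insert v (U \<union> S)) E"
    using E fin by (subst acyc_insert_pendant) (auto simp: pendant_forests_def forest_on_def)
  with E E1 n n' pairs_mono[of "U \<union> S" "insert v (U \<union> S)"] show "E \<in> ?L"
    by (auto simp: pendant_forests_def forest_on_def)
qed

lemma nbrs_insert_edge:
  assumes "F \<subseteq> pairs (U \<union> S)" "u \<in> U \<union> S"
  shows "nbrs (insert {u, v} F) (U \<union> insert v S) v = {u}"
    and "X \<subseteq> U \<union> S \<Longrightarrow> x \<in> X \<Longrightarrow> nbrs (insert {u, v} F) X x = nbrs F X x"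
    and "x \<in> U \<union> S \<Longrightarrow>
      nbrs (insert {u, v} F) (U \<union> insert v S) x = nbrs F (U \<union> S) x \<union> (if x = u then {v} else {})"
  using assms v by (auto simp: nbrs_def doubleton_eq_iff)

text \<open>If \<open>u\<close> lies in \<open>S\<close>, the new edge uses up the one edge allowed
  at \<open>u\<close>, hence the condition that \<open>u\<close> is isolated in \<open>F\<close>. A
  vertex \<open>u\<close> of \<open>U\<close> carries no such restriction.\<close>

lemma insert_edge_pendant_iff:
  assumes F: "F \<subseteq> pairs (U \<union> S)" "u \<in> U \<union> S"
  shows "insert {u, v} F \<in> pendant_forests U (insert v S) \<longleftrightarrow>
    F \<in> pendant_forests U S \<and> (u \<in> S \<longrightarrow> nbrs F (U \<union> S) u = {})"
proof -
  let ?E = "insert {u, v} F"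
  note n = nbrs_insert_edge[OF F]
  have "acyc (insert v (U \<union> S)) ?E \<longleftrightarrow> acyc (U \<union> S) ?E"
    using n(1) fin by (intro acyc_insert_pendant) auto
  also have "\<dots> \<longleftrightarrow> acyc (U \<union> S) F"
    by (simp add: acyc_def n(2) cong: conj_cong)
  finally have a: "acyc (U \<union> insert v S) ?E \<longleftrightarrow> acyc (U \<union> S) F" by simp
  have p: "?E \<subseteq> pairs (U \<union> insert v S)"
    using F v pairs_mono[of "U \<union> S" "insert v (U \<union> S)"] by auto
  have c: "card (nbrs ?E (U \<union> insert v S) s) \<le> 1 \<longleftrightarrow>
      card (nbrs F (U \<union> S) s) \<le> 1 \<and> (s = u \<longrightarrow> nbrs F (U \<union> S) u = {})" if "s \<in> S" for s
  proof -
    have "v \<notin> nbrs F (U \<union> S) s" using v by (auto simp: nbrs_def)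
    then show ?thesis using that fin by (subst n(3)) auto
  qed
  show ?thesis
    using a p c F n(1) by (auto simp: pendant_forests_def forest_on_def)
qed

lemma pendant_forests_attached:
  assumes u: "u \<in> U \<union> S"
  shows "card {E \<in> pendant_forests U (insert v S). nbrs E (U \<union> insert v S) v = {u}} =
    card {F \<in> pendant_forests U S. u \<in> S \<longrightarrow> nbrs F (U \<union> S) u = {}}" (is "card ?L = card ?R")
proof -
  have "?L = insert {u, v} ` ?R"
  proof (intro set_eqI iffI)
    fix E assume E: "E \<in> ?L"
    define F where "F = E - {{u, v}}"
    from E have uv: "{u, v} \<in> E" by (auto simp: nbrs_def)
    then have EF: "E = insert {u, v} F" by (auto simp: F_def)
    have "x = {u, v}" if "x \<in> E" "x \<notin> pairs (U \<union> S)" for x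
    proof -
      have "x \<in> pairs (U \<union> insert v S)"
        using that E by (auto simp: pendant_forests_def forest_on_def)
      then obtain a b where "x = {a, b}" "a \<in> U \<union> insert v S" "b \<in> U \<union> insert v S" "a \<noteq> b"
        by (elim pairs_cases)
      with that obtain a where a: "x = {a, v}" "a \<in> U \<union> S"
        by (auto simp: insert_commute)
      then have "a \<in> nbrs E (U \<union> insert v S) v" using that v by (auto simp: nbrs_def)
      then show ?thesis using E a by auto
    qed
    then have "F \<subseteq> pairs (U \<union> S)" by (auto simp: F_def)
    then show "E \<in> insert {u, v} ` ?R"
      using insert_edge_pendant_iff[OF _ u, of F] E EF by auto
  next
    fix E assume "E \<in> insert {u, v} ` ?R"
    then obtain F where F: "F \<in> ?R" "E = insert {u, v} F" by auto
    then have "F \<subseteq> pairs (U \<union> S)" by (auto simp: pendant_forests_def forest_on_def)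
    then show "E \<in> ?L"
      using insert_edge_pendant_iff[OF _ u, of F] nbrs_insert_edge(1)[OF _ u] F by auto
  qed
  moreover have "inj_on (insert {u, v}) ?R"
  proof (rule inj_onI)
    fix F G assume "F \<in> ?R" "G \<in> ?R" and eq: "insert {u, v} F = insert {u, v} G"
    then have "{u, v} \<notin> F" "{u, v} \<notin> G"
      using v by (auto simp: pendant_forests_def forest_on_def)
    with eq show "F = G" by (metis insert_ident)
  qed
  ultimately show ?thesis by (simp add: card_image)
qed

end

text \<open>Case distinction on the neighbourhood of \<open>v\<close>. If it is empty or a single
  vertex of \<open>U\<close>, there are \<open>card U + 1\<close> choices over a pendant forest for
  \<open>S\<close>. If it is a single \<open>s\<close> in \<open>S\<close>, then
  \<open>{s, v}\<close> is a component of its own and both vertices drop out.\<close>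

lemma card_pendant_forests_insert:
  assumes fin: "finite U" "finite S" and v: "v \<notin> U" "v \<notin> S" and disj: "U \<inter> S = {}"
  shows "card (pendant_forests U (insert v S)) =
    (card U + 1) * card (pendant_forests U S) + (\<Sum>s\<in>S. card (pendant_forests U (S - {s})))"
proof -
  let ?V = "U \<union> S"
  let ?P = "pendant_forests U (insert v S)"
  let ?n = "\<lambda>E. nbrs E (U \<union> insert v S) v"
  let ?I = "insert {} ((\<lambda>u. {u}) ` ?V)"
  have "?n E \<in> ?I" if "E \<in> ?P" for E
  proof -
    have "card (?n E) \<le> 1" "?n E \<subseteq> ?V" using that by (auto simp: pendant_forests_def nbrs_def)
    moreover have "finite (?n E)" using fin by auto
    ultimately show ?thesis by (auto simp: le_Suc_eq card_1_singleton_iff)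
  qed
  then have "?P = (\<Union>A\<in>?I. {E \<in> ?P. ?n E = A})" by auto
  also have "card \<dots> = (\<Sum>A\<in>?I. card {E \<in> ?P. ?n E = A})"
    using fin by (intro card_UN_disjoint) auto
  also have "\<dots> = card {E \<in> ?P. ?n E = {}} + (\<Sum>u\<in>?V. card {E \<in> ?P. ?n E = {u}})"
    using fin by (subst sum.insert) (auto simp: sum.reindex)
  also have "\<dots> = card (pendant_forests U S) +
      (\<Sum>u\<in>?V. card {F \<in> pendant_forests U S. u \<in> S \<longrightarrow> nbrs F ?V u = {}})"
    unfolding pendant_forests_isolated[OF assms]
    by (simp only: pendant_forests_attached[OF assms] cong: sum.cong)
  also have "(\<Sum>u\<in>?V. card {F \<in> pendant_forests U S. u \<in> S \<longrightarrow> nbrs F ?V u = {}}) =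
     (\<Sum>u\<in>U. card {F \<in> pendant_forests U S. u \<in> S \<longrightarrow> nbrs F ?V u = {}}) +
     (\<Sum>u\<in>S. card {F \<in> pendant_forests U S. u \<in> S \<longrightarrow> nbrs F ?V u = {}})"
    using fin disj by (intro sum.union_disjoint) auto
  also have "(\<Sum>u\<in>U. card {F \<in> pendant_forests U S. u \<in> S \<longrightarrow> nbrs F ?V u = {}}) =
     (\<Sum>u\<in>U. card (pendant_forests U S))"
    using disj by (intro sum.cong refl arg_cong[of _ _ card]) auto
  also have "(\<Sum>u\<in>S. card {F \<in> pendant_forests U S. u \<in> S \<longrightarrow> nbrs F ?V u = {}}) =
     (\<Sum>s\<in>S. card (pendant_forests U (S - {s})))"
  proof (intro sum.cong refl)
    fix s assume s: "s \<in> S"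
    then have "insert s (S - {s}) = S" by auto
    moreover have "s \<notin> U" "U \<inter> (S - {s}) = {}" "U \<union> S = U \<union> insert s (S - {s})"
      using s disj by auto
    ultimately show "card {F \<in> pendant_forests U S. s \<in> S \<longrightarrow> nbrs F ?V s = {}} =
        card (pendant_forests U (S - {s}))"
      using pendant_forests_isolated[of U "S - {s}" s] fin s by simp
  qed
  finally show ?thesis by simp
qed

text \<open>
  The number of ways to attach \<open>i\<close> vertices of degree at most one to \<open>y - 1\<close> given vertices: each is
  isolated, joined to a given vertex, or matched with another new one. The exponential generating
  function in \<open>i\<close> is \<open>exp (y w + w^2 / 2)\<close>.
\<close>

fun herm :: "nat \<Rightarrow> nat \<Rightarrow> nat" where
  "herm y 0 = 1"
| "herm y (Suc 0) = y"
| "herm y (Suc (Suc i)) = y * herm y (Suc i) + Suc i * herm y i"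

lemma card_pendant_forests:
  assumes "finite U" "finite S" "U \<inter> S = {}"
  shows "card (pendant_forests U S) = card (forest_on U) * herm (card U + 1) (card S)"
  using assms(2,3)
proof (induction "card S" arbitrary: S rule: less_induct)
  case less
  show ?case
  proof (cases "S = {}")
    case True then show ?thesis by (simp add: pendant_forests_def)
  next
    case False
    then obtain v S' where S': "S = insert v S'" "v \<notin> S'" by (metis Set.set_insert equals0I)
    have fin: "finite S'" using S' less.prems by auto
    have "card (pendant_forests U S) = (card U + 1) * card (pendant_forests U S') +
        (\<Sum>s\<in>S'. card (pendant_forests U (S' - {s})))"
      unfolding S' using S' less.prems assms(1) by (intro card_pendant_forests_insert) auto
    also have "card (pendant_forests U S') = card (forest_on U) * herm (card U + 1) (card S')"
      using S' less.prems by (intro less.hyps) auto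
    also have "(\<Sum>s\<in>S'. card (pendant_forests U (S' - {s}))) =
       (\<Sum>s\<in>S'. card (forest_on U) * herm (card U + 1) (card S' - 1))"
    proof (intro sum.cong refl)
      fix s assume s: "s \<in> S'"
      have "card (S' - {s}) < card S"
        using S' s fin by (metis Diff_subset card_mono card_insert_disjoint le_imp_less_Suc)
      then show "card (pendant_forests U (S' - {s})) = card (forest_on U) * herm (card U +
          1) (card S' - 1)"
        using S' less.prems s by (subst less.hyps) auto
    qed
    also have "(card U + 1) * (card (forest_on U) * herm (card U + 1) (card S')) + \<dots> =
        card (forest_on U) * herm (card U + 1) (card S)"
      using S' fin by (cases "card S'") (auto simp: algebra_simps)
    finally show ?thesis .
  qed
qed

section \<open>Inclusion-exclusion over the vertices of low degree\<close>

lemma sum_Pow_alternating: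
  assumes "finite L" "L \<noteq> {}"
  shows "(\<Sum>S\<in>Pow L. (-1) ^ card S) = (0 :: 'a :: comm_ring_1)"
  using prod_diff_conv_sum[OF assms(1), of "\<lambda>_. 1 :: 'a" "\<lambda>_. 1"] assms
  by (simp add: zero_power card_gt_0_iff)

lemma sum_Pow_card:
  fixes g :: "nat \<Rightarrow> 'b :: semiring_1"
  assumes "finite V"
  shows "(\<Sum>S\<in>Pow V. g (card S)) = (\<Sum>i\<le>card V. of_nat (card V choose i) * g i)"
proof -
  have "(\<Sum>S\<in>Pow V. g (card S)) = (\<Sum>i\<le>card V. \<Sum>S\<in>{S \<in> Pow V. card S = i}. g (card S))"
    using assms by (intro sum.group[symmetric]) (auto simp: card_mono)
  also have "\<dots> = (\<Sum>i\<le>card V. of_nat (card V choose i) * g i)"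
    using n_subsets[OF assms] by (intro sum.cong refl) simp
  finally show ?thesis .
qed

text \<open>For fixed \<open>S\<close>, \<open>card_pendant_forests\<close> counts the forests in
  which every vertex of \<open>S\<close> has degree at most one. After exchanging the sums, each
  forest contributes the alternating sum over all subsets of its low-degree vertices, which vanishes
  because acyclicity provides such a vertex.\<close>

lemma alternating_sum_forests:
  assumes "finite V" "V \<noteq> {}"
  shows "(\<Sum>S\<in>Pow V. (-1) ^ card S * int (card (forest_on (V - S)) * herm (card V - card S +
      1) (card S))) = 0"
proof -
  define L where "L = (\<lambda>E. {v \<in> V. card (nbrs E V v) \<le> 1})"
  have "(\<Sum>S\<in>Pow V. (-1) ^ card S * int (card (forest_on (V - S)) * herm (card V - card S +
      1) (card S)))
      = (\<Sum>S\<in>Pow V. (-1) ^ card S * int (card {E \<in> forest_on V. S \<subseteq> L E}))"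
  proof (intro sum.cong refl)
    fix S assume "S \<in> Pow V"
    then have S: "S \<subseteq> V" "finite S" using assms finite_subset by auto
    then have "{E \<in> forest_on V. S \<subseteq> L E} = pendant_forests (V - S) S"
      unfolding pendant_forests_def L_def by (auto simp: Un_absorb2)
    then show "(-1) ^ card S * int (card (forest_on (V - S)) * herm (card V - card S +
        1) (card S)) =
      (-1) ^ card S * int (card {E \<in> forest_on V. S \<subseteq> L E})"
      using S assms card_pendant_forests[of "V - S" S]
          by (simp add: card_Diff_subset Diff_disjoint Int_commute)
  qed
  also have "\<dots> = (\<Sum>S\<in>Pow V. \<Sum>E\<in>forest_on V. if S \<subseteq> L E then (-1) ^ card S else 0)"
    using assms by (simp add: sum.If_cases Int_def mult.commute)
  also have "\<dots> = (\<Sum>E\<in>forest_on V. \<Sum>S\<in>Pow V. if S \<subseteq> L E then (-1) ^ card S else 0)"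
    by (rule sum.swap)
  also have "\<dots> = (\<Sum>E\<in>forest_on V. \<Sum>S\<in>Pow (L E). (-1) ^ card S)"
  proof (rule sum.cong[OF refl])
    fix E
    have "Pow V \<inter> {S. S \<subseteq> L E} = Pow (L E)" by (auto simp: L_def)
    then show "(\<Sum>S\<in>Pow V. if S \<subseteq> L E then (-1) ^ card S else 0) =
        (\<Sum>S\<in>Pow (L E). (-1) ^ card S :: int)"
      using assms by (simp add: sum.If_cases)
  qed
  also have "\<dots> = 0"
  proof (rule sum.neutral, rule ballI, rule sum_Pow_alternating)
    fix E assume "E \<in> forest_on V"
    then show "L E \<noteq> {}" using assms by (auto simp: forest_on_def acyc_def L_def)
    show "finite (L E)" using assms by (auto simp: L_def)
  qed
  finally show ?thesis .
qed

definition nforests :: "nat \<Rightarrow> nat" where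
  "nforests n = card (forest_on {1..n})"

lemma card_forest_on_image:
  assumes g: "inj_on g V"
  shows "card (forest_on (g ` V)) = card (forest_on V)"
proof -
  have pairs: "pairs (g ` V) = image g ` pairs V"
  proof (intro set_eqI iffI)
    fix e assume "e \<in> pairs (g ` V)"
    then obtain u v where "u \<in> V" "v \<in> V" "g u \<noteq> g v" "e = g ` {u, v}"
      by (auto elim!: pairs_cases)
    then show "e \<in> image g ` pairs V" by (intro image_eqI[of _ _ "{u, v}"]) auto
  qed (auto elim!: pairs_cases dest: inj_onD[OF g])
  have inj_image: "inj_on (image g) (Pow V)"
    by (rule inj_on_image_Pow[OF g])
  have nbrs: "nbrs (image g ` E) (g ` X) (g v) = g ` nbrs E X v"
    if "E \<subseteq> pairs V" "X \<subseteq> V" "v \<in> X" for E X v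
  proof -
    have "g ` {u, v} \<in> image g ` E \<longleftrightarrow> {u, v} \<in> E" if "u \<in> X" for u
      using that \<open>E \<subseteq> pairs V\<close> \<open>X \<subseteq> V\<close> \<open>v \<in> X\<close>
      by (intro inj_on_image_mem_iff[OF inj_image]) (auto simp: pairs_def)
    moreover have "g u \<noteq> g v \<longleftrightarrow> u \<noteq> v" if "u \<in> X" for u
      using that \<open>X \<subseteq> V\<close> \<open>v \<in> X\<close> inj_onD[OF g] by blast
    ultimately show ?thesis by (auto simp: nbrs_def)
  qed
  have acyc: "acyc (g ` V) (image g ` E) \<longleftrightarrow> acyc V E" if "E \<subseteq> pairs V" for E
  proof -
    have "card (g ` nbrs E X v) = card (nbrs E X v)" if "X \<subseteq> V" for X v
      using that g by (intro card_image inj_on_subset[OF g]) (auto simp: nbrs_def)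
    then show ?thesis
      by (simp add: acyc_def all_subset_image nbrs[OF that] cong: conj_cong)
  qed
  have "forest_on (g ` V) = image (image g) ` forest_on V"
  proof (intro set_eqI iffI)
    fix E assume E: "E \<in> forest_on (g ` V)"
    then obtain F where "F \<subseteq> pairs V" "E = image g ` F"
      by (auto simp: forest_on_def pairs subset_image_iff)
    with E acyc show "E \<in> image (image g) ` forest_on V"
      by (auto simp: forest_on_def)
  next
    fix E assume "E \<in> image (image g) ` forest_on V"
    with acyc show "E \<in> forest_on (g ` V)"
      by (auto simp: forest_on_def pairs)
  qed
  moreover have "inj_on (image (image g)) (forest_on V)"
  proof (rule inj_on_subset[OF inj_on_image_Pow])
    show "inj_on (image g) (pairs V)"
      by (rule inj_on_subset[OF inj_image]) (auto simp: pairs_def)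
  qed (auto simp: forest_on_def)
  ultimately show ?thesis by (simp add: card_image)
qed

lemma card_forest_on:
  assumes "finite V" shows "card (forest_on V) = nforests (card V)"
proof -
  obtain g where "bij_betw g {1..card V} V"
    using ex_bij_betw_nat_finite_1[OF assms] by auto
  then show ?thesis
    using card_forest_on_image[of g "{1..card V}"] by (simp add: nforests_def bij_betw_def)
qed

lemma nforests_alternating_sum:
  assumes "n > 0"
  shows "(\<Sum>i\<le>n. (-1) ^ i * real (n choose i) * real (nforests (n - i)) * real (herm (n - i +
      1) i)) = 0"
proof -
  let ?V = "{1..n}"
  have "(\<Sum>i\<le>n. (-1) ^ i * int (n choose i) * int (nforests (n - i)) * int (herm (n - i + 1) i)) =
    (\<Sum>i\<le>card ?V. of_nat (card ?V choose i) * ((-1) ^ i * int (nforests (n - i) * herm (n - i +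
        1) i)))"
    by (intro sum.cong) auto
  also have "\<dots> = (\<Sum>S\<in>Pow ?V. (-1) ^ card S * int (nforests (n - card S) * herm (n - card S +
      1) (card S)))"
    by (rule sum_Pow_card[symmetric]) simp
  also have "\<dots> = (\<Sum>S\<in>Pow ?V. (-1) ^ card S * int (card (forest_on (?V - S)) *
      herm (card ?V - card S + 1) (card S)))"
    by (intro sum.cong refl) (auto simp: card_forest_on card_Diff_subset finite_subset)
  also have "\<dots> = 0"
    using assms by (intro alternating_sum_forests) auto
  finally have "real_of_int (\<Sum>i\<le>n. (-1) ^ i * int (n choose i) * int (nforests (n - i)) *
      int (herm (n - i + 1) i)) = 0"
    by simp
  then show ?thesis by simp
qed

lemma nforests_0 [simp]: "nforests 0 = 1"
proof -
  have "pairs {} = ({} :: nat set set)" by (auto simp: pairs_def)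
  then have "forest_on {} = {{} :: nat set set}" by (auto simp: forest_on_def acyc_def)
  then show ?thesis by (simp add: nforests_def)
qed

section \<open>Asymptotic number of forests\<close>

text \<open>The factor common to the series of \<open>herm y\<close> for all \<open>y\<close>; the
  inversion removes it by a single multiplication with its inverse.\<close>

definition hermite_fps :: "real fps" where
  "hermite_fps = fps_exp (1/2) oo fps_X ^ 2"

lemma fps_deriv_exp_times_hermite:
  fixes y :: real
  shows "fps_deriv (fps_exp (- y) * hermite_fps) = (fps_X - fps_const y) * (fps_exp (- y) *
      hermite_fps)"
proof -
  have "fps_deriv hermite_fps = (fps_const (1/2) * fps_exp (1/2) oo fps_X ^ 2) *
      fps_deriv (fps_X ^ 2)"
    unfolding hermite_fps_def by (subst fps_compose_deriv) auto
  also have "\<dots> = hermite_fps * (fps_const (1/2) * fps_deriv (fps_X ^ 2))"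
    by (subst fps_compose_mult_distrib) (auto simp: hermite_fps_def algebra_simps)
  also have "fps_const (1/2) * fps_deriv (fps_X ^ 2) = (fps_X :: real fps)"
    by (simp add: fps_deriv_power fps_eq_iff)
  finally show ?thesis
    by (simp add: algebra_simps fps_const_neg[symmetric] del: fps_const_neg)
qed

text \<open>The sign (-1)^i of inclusion-exclusion turns exp(y w + w^2 / 2) into exp(-y w + w^2 /
  2). The differential equation above, read coefficientwise, is the signed recursion of
  \<open>herm\<close>. It has order two, so the induction carries two consecutive
  coefficients.\<close>

lemma exp_times_hermite_nth:
  "(fps_exp (- real y) * hermite_fps) $ i = (-1) ^ i * real (herm y i) / fact i"
proof -
  define Z where "Z = fps_exp (- real y) * hermite_fps"
  have deriv: "real (Suc i) * Z $ Suc i = (fps_X * Z) $ i - real y * Z $ i" for i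
    using arg_cong[OF fps_deriv_exp_times_hermite[of "real y"], of "\<lambda>F. F $ i"]
    unfolding Z_def[symmetric] by (simp add: left_diff_distrib)
  have Z0: "Z $ 0 = 1" by (simp add: Z_def hermite_fps_def)
  have "Z $ i = (-1) ^ i * real (herm y i) / fact i \<and>
    Z $ Suc i = (-1) ^ Suc i * real (herm y (Suc i)) / fact (Suc i)"
  proof (induction i)
    case 0
    then show ?case using deriv[of 0] Z0 by simp
  next
    case (Suc i)
    have "real (Suc (Suc i)) * Z $ Suc (Suc i) = Z $ i - real y * Z $ Suc i"
      using deriv[of "Suc i"] by simp
    also have "\<dots> = (-1) ^ i * real (herm y (Suc (Suc i))) / fact (Suc i)"
    proof -
      obtain F :: real where F: "F = fact (Suc i)" "F > 0" by simp
      have "Z $ i = (-1) ^ i * (real (Suc i) * real (herm y i)) / F"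
        using Suc by (simp add: F)
      moreover have "Z $ Suc i = - ((-1) ^ i * real (herm y (Suc i)) / F)"
        using Suc by (simp add: F)
      ultimately show ?thesis using F(2) unfolding F(1)[symmetric]
        by (simp only: herm.simps of_nat_add of_nat_mult) (simp add: diff_divide_distrib
            add_divide_distrib algebra_simps)
    qed
    finally have "Z $ Suc (Suc i) = (-1) ^ i *
        real (herm y (Suc (Suc i))) / fact (Suc i) / real (Suc (Suc i))"
      by (metis nonzero_mult_div_cancel_left of_nat_eq_0_iff nat.distinct(2))
    then show ?case
      using Suc by (simp add: divide_divide_eq_left mult.commute del: of_nat_Suc herm.simps)
  qed
  then show ?thesis by (simp add: Z_def)
qed

definition hermite_inv_fps :: "real fps" where
  "hermite_inv_fps = fps_exp (- 1/2) oo fps_X ^ 2"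

lemma hermite_inv_fps_nth:
  "hermite_inv_fps $ j = (if even j then (- 1/2) ^ (j div 2) / fact (j div 2) else 0)"
  by (simp add: hermite_inv_fps_def fps_nth_compose_X_power)

lemma hermite_fps_inverse: "hermite_inv_fps * hermite_fps = 1"
proof -
  have "hermite_inv_fps * hermite_fps = (fps_exp (- 1/2) * fps_exp (1/2) oo fps_X ^ 2)"
    unfolding hermite_fps_def hermite_inv_fps_def by (subst fps_compose_mult_distrib) auto
  also have "fps_exp (- 1/2) * fps_exp (1/2 :: real) = 1"
    by (simp flip: fps_exp_add_mult)
  finally show ?thesis by simp
qed

text \<open>The coefficient vanishes for y = d > 0, which is the orthogonality behind the inversion.
  For y = n + 1 and d = n - j the numerator is j + 1, the weight in the explicit sum.\<close>

lemma one_minus_X_times_exp_nth: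
  fixes y :: real
  assumes "y \<noteq> 0"
  shows "((1 - fps_X) * fps_exp y) $ d = y ^ d / fact d * ((y - real d) / y)"
proof (cases d)
  case (Suc d')
  have "y ^ Suc d' / (D * fact d') - y ^ d' / fact d' = y ^ Suc d' / (D * fact d') * ((y - D) / y)"
    if "D > 0" for D :: real
    using that assms by (simp add: field_simps)
  from this[of "real d"] have "y ^ d / fact d - y ^ d' / fact d' = y ^ d / fact d *
      ((y - real d) / y)"
    using Suc by (simp only: fact_Suc of_nat_0_less_iff of_nat_Suc of_nat_fact)
  then show ?thesis
    using Suc by (simp add: left_diff_distrib del: fact_Suc)
qed (use assms in \<open>simp add: left_diff_distrib\<close>)

text \<open>Divided by \<open>fact j\<close>, the recursion for the forest numbers is the
  coefficient of w^j in F(w exp(-w)) exp(-w) exp(w^2 / 2) = 1.\<close>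

lemma nforests_hermite_convolution:
  "(\<Sum>m\<le>j. real (nforests m) / fact m * (fps_exp (- real (m + 1)) * hermite_fps) $ (j - m)) =
     (if j = 0 then 1 else 0)"
proof (cases "j = 0")
  case True
  then show ?thesis by (simp add: hermite_fps_def)
next
  case False
  have "(\<Sum>m\<le>j. real (nforests m) / fact m * (fps_exp (- real (m + 1)) * hermite_fps) $ (j - m)) =
    (\<Sum>m\<le>j. real (nforests m) / fact m * ((-1) ^ (j - m) * real (herm (m +
        1) (j - m)) / fact (j - m)))"
    by (subst exp_times_hermite_nth) simp
  also have "\<dots> = (\<Sum>i\<le>j. real (nforests (j - i)) / fact (j - i) * ((-1) ^ i * real (herm (j - i +
      1) i) / fact i))"
    by (rule sum.reindex_bij_witness[of _ "\<lambda>i. j - i" "\<lambda>i. j - i"]) auto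
  also have "\<dots> = (\<Sum>i\<le>j. (-1) ^ i * real (j choose i) * real (nforests (j - i)) * real (herm (j - i
      + 1) i)) / fact j"
    unfolding sum_divide_distrib
    by (intro sum.cong refl) (simp add: binomial_fact field_simps)
  also have "\<dots> = 0"
    using nforests_alternating_sum[of j] False by simp
  finally show ?thesis using False by simp
qed

text \<open>Lagrange inversion of \<open>F (w exp (-w)) = exp (w - w^2 / 2)\<close>, truncated at degree \<open>n\<close>.\<close>

lemma nforests_eq_coeff:
  "real (nforests n) / fact n = ((1 - fps_X) * fps_exp (real (n + 1)) * hermite_inv_fps) $ n"
proof -
  define \<phi> where "\<phi> m = real (nforests m) / fact m" for m
  define A :: "real fps" where "A = (1 - fps_X) * fps_exp (real (n + 1))"
  \<comment> \<open>This is F(w exp(-w)) exp(-w) cut off after \<open>m = n\<close>. The omitted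
    terms start at w^(n + 1), so all coefficients up to degree \<open>n\<close> are exact.\<close>
  define \<Phi> :: "real fps" where "\<Phi> = (\<Sum>m\<le>n. fps_const (\<phi> m) * (fps_X ^ m * fps_exp (- real (m +
      1))))"
  have *: "(\<Phi> * hermite_fps) $ j = (if j = 0 then 1 else 0)" if "j \<le> n" for j
  proof -
    have "(\<Phi> * hermite_fps) $ j = (\<Sum>m\<le>n. \<phi> m * (fps_X ^ m * (fps_exp (- real (m + 1)) *
        hermite_fps)) $ j)"
      by (simp add: \<Phi>_def sum_distrib_right fps_sum_nth mult.assoc)
    also have "\<dots> = (\<Sum>m\<le>j. \<phi> m * (fps_exp (- real (m + 1)) * hermite_fps) $ (j - m))"
      using that by (intro sum.mono_neutral_cong_right) (auto simp: fps_X_power_mult_nth)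
    finally show ?thesis by (simp only: nforests_hermite_convolution \<phi>_def)
  qed
  \<comment> \<open>The new factor agrees with 1 up to degree \<open>n\<close>, so it can be
    multiplied in without changing the coefficient at \<open>n\<close>.\<close>
  have "(A * hermite_inv_fps) $ n = (A * hermite_inv_fps * (\<Phi> * hermite_fps)) $ n"
  proof -
    have "(A * hermite_inv_fps * (\<Phi> * hermite_fps)) $ n =
       (\<Sum>i=0..n. (A * hermite_inv_fps) $ i * (if i = n then 1 else 0))"
      unfolding fps_mult_nth[of "A * hermite_inv_fps"] by (intro sum.cong refl) (simp add: *)
    also have "\<dots> = (\<Sum>i=0..n. if i = n then (A * hermite_inv_fps) $ i else 0)"
      by (intro sum.cong) auto
    finally show ?thesis by (simp add: sum.delta)
  qed
  also have "A * hermite_inv_fps * (\<Phi> * hermite_fps) = A * \<Phi> * (hermite_inv_fps * hermite_fps)"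
    by (simp only: mult_ac)
  also have "\<dots> = A * \<Phi>" by (simp add: hermite_fps_inverse)
  also have "(A * \<Phi>) $ n = (\<Sum>m\<le>n. \<phi> m * (fps_X ^ m * ((1 - fps_X) * (fps_exp (real (n + 1)) *
      fps_exp (- real (m + 1))))) $ n)"
  proof -
    have "A * \<Phi> = (\<Sum>m\<le>n. fps_const (\<phi> m) * (fps_X ^ m * ((1 - fps_X) * (fps_exp (real (n + 1)) *
        fps_exp (- real (m + 1))))))"
      unfolding A_def \<Phi>_def sum_distrib_left by (intro sum.cong refl) (simp only: mult_ac)
    then show ?thesis by (simp add: fps_sum_nth)
  qed
  also have "\<dots> = (\<Sum>m\<le>n. \<phi> m * (if m = n then 1 else 0))"
  proof (intro sum.cong refl arg_cong2[of _ _ _ _ "(*)"])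
    fix m assume m: "m \<in> {..n}"
    have "fps_exp (real (n + 1)) * fps_exp (- real (m + 1)) = fps_exp (real (n - m))"
      using m by (simp flip: fps_exp_add_mult add: of_nat_diff)
    then have "(fps_X ^ m * ((1 - fps_X) * (fps_exp (real (n + 1)) * fps_exp (- real (m +
        1))))) $ n =
        ((1 - fps_X) * fps_exp (real (n - m))) $ (n - m)"
      using m by (simp only: fps_X_power_mult_nth) simp
    also have "\<dots> = (if m = n then 1 else 0)"
    \<comment> \<open>For \<open>m < n\<close> exponent and degree are both \<open>n - m\<close>;
      this is the reason for the parameter \<open>n + 1\<close> in \<open>A\<close>. All these terms
      vanish and only \<open>\<phi> n\<close> survives.\<close>
    proof (cases "m = n")
      case False
      then show ?thesis using m by (subst one_minus_X_times_exp_nth) auto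
    qed (simp add: left_diff_distrib)
    finally show "(fps_X ^ m * ((1 - fps_X) * (fps_exp (real (n + 1)) * fps_exp (- real (m +
        1))))) $ n
       = (if m = n then 1 else 0)" .
  qed
  also have "\<dots> = (\<Sum>m\<le>n. if m = n then \<phi> m else 0)" by (intro sum.cong) auto
  also have "\<dots> = \<phi> n" by (simp add: sum.delta)
  finally show ?thesis by (simp add: A_def \<phi>_def)
qed

section \<open>Explicit sum for the number of forests\<close>

text \<open>This is n (n - 1) ... (n - j + 1) / (n + 1)^j. As a product it vanishes for j > n
  through the factor with i = n + 1, so the finite sum over j becomes an infinite series with
  coefficients independent of n.\<close>

definition falling_ratio :: "nat \<Rightarrow> nat \<Rightarrow> real" where
  "falling_ratio n j = (\<Prod>i=1..j. 1 - real i / real (n + 1))"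

lemma falling_ratio_Suc: "falling_ratio n (Suc j) = falling_ratio n j *
    (1 - real (Suc j) / real (n + 1))"
  by (simp add: falling_ratio_def)

lemma falling_ratio_eq:
  assumes "j \<le> n" shows "falling_ratio n j = fact n / (fact (n - j) * real (n + 1) ^ j)"
  using assms
proof (induction j)
  case (Suc j)
  have "fact (n - j) = real (n - j) * fact (n - Suc j)"
    using Suc.prems by (metis Suc_diff_Suc Suc_le_lessD fact_Suc of_nat_fact of_nat_mult)
  then show ?case using Suc
    by (simp add: falling_ratio_Suc of_nat_diff divide_simps)
qed (simp add: falling_ratio_def)

lemma falling_ratio_eq_0: "j > n \<Longrightarrow> falling_ratio n j = 0"
  by (auto simp: falling_ratio_def intro!: bexI[of _ "n + 1"])

lemma nforests_eq_sum:
  "real (nforests n) = real (n + 1) ^ n / real (n + 1) *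
     (\<Sum>j\<le>n. hermite_inv_fps $ j * real (j + 1) * falling_ratio n j)"
proof -
  have "real (nforests n) = fact n * (\<Sum>j\<le>n. hermite_inv_fps $ j * ((1 - fps_X) * fps_exp (real (n
      + 1))) $ (n - j))"
  proof -
    have "real (nforests n) = fact n * (hermite_inv_fps * ((1 - fps_X) * fps_exp (real (n +
        1)))) $ n"
      by (subst mult.commute, subst nforests_eq_coeff[symmetric]) simp
    then show ?thesis by (simp only: fps_mult_nth[of hermite_inv_fps] atMost_atLeast0)
  qed
  also have "\<dots> = (\<Sum>j\<le>n. real (n + 1) ^ n / real (n + 1) * (hermite_inv_fps $ j * real (j + 1) *
      falling_ratio n j))"
    unfolding sum_distrib_left
  proof (intro sum.cong refl)
    fix j assume j: "j \<in> {..n}"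
    define N where "N = real (n + 1)"
    have N: "N > 0" by (simp add: N_def)
    have "((1 - fps_X) * fps_exp N) $ (n - j) = N ^ (n - j) / fact (n - j) * (real (j + 1) / N)"
      using j N by (subst one_minus_X_times_exp_nth) (auto simp: N_def of_nat_diff)
    moreover have "falling_ratio n j = fact n / (fact (n - j) * N ^ j)"
      using j by (simp add: falling_ratio_eq N_def)
    moreover have "N ^ n = N ^ j * N ^ (n - j)" using j by (simp flip: power_add)
    ultimately show "fact n * (hermite_inv_fps $ j * ((1 - fps_X) * fps_exp (real (n +
        1))) $ (n - j)) =
       real (n + 1) ^ n / real (n + 1) * (hermite_inv_fps $ j * real (j + 1) * falling_ratio n j)"
      using N unfolding N_def[symmetric] by (simp only:) (simp add: field_simps)
  qed
  finally show ?thesis by (simp add: sum_distrib_left)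
qed

text \<open>The coefficients in the formula of Takacs, f(n) = n! / (n + 1) times the sum over k of
  (-1/2)^k (2 k + 1) (n + 1)^(n - 2 k) / (k! (n - 2 k)!). Only even indices occur because exp(-w^2 /
  2) is even.\<close>

definition takacs_coeff :: "nat \<Rightarrow> real" where
  "takacs_coeff k = (- 1/2) ^ k / fact k * real (2 * k + 1)"

lemma nforests_eq_suminf:
  "(\<lambda>k. takacs_coeff k * falling_ratio n (2 * k)) sums (real (nforests n) * real (n + 1) / real (n
      + 1) ^ n)"
proof -
  have "(\<lambda>k. takacs_coeff k * falling_ratio n (2 * k)) sums (\<Sum>k\<in>{k. 2 * k \<le> n}. takacs_coeff k *
      falling_ratio n (2 * k))"
    by (rule sums_finite) (auto intro: finite_subset[of _ "{..n}"] simp: falling_ratio_eq_0)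
  also have "(\<Sum>k\<in>{k. 2 * k \<le> n}. takacs_coeff k * falling_ratio n (2 * k)) =
     (\<Sum>j\<in>{j. j \<le> n \<and> even j}. hermite_inv_fps $ j * real (j + 1) * falling_ratio n j)"
    by (rule sum.reindex_bij_witness[of _ "\<lambda>j. j div 2" "\<lambda>k. 2 * k"])
       (auto simp: hermite_inv_fps_nth takacs_coeff_def)
  also have "\<dots> = (\<Sum>j\<le>n. hermite_inv_fps $ j * real (j + 1) * falling_ratio n j)"
    by (intro sum.mono_neutral_left) (auto simp: hermite_inv_fps_nth)
  also have "\<dots> = real (nforests n) * real (n + 1) / real (n + 1) ^ n"
  proof -
    define N S where "N = real (n + 1)" and "S = (\<Sum>j\<le>n. hermite_inv_fps $ j * real (j + 1) *
        falling_ratio n j)"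
    have "N > 0" "real (nforests n) = N ^ n / N * S"
      using nforests_eq_sum[of n] by (simp_all add: N_def S_def)
    then have "S = real (nforests n) * N / N ^ n" by (simp add: field_simps)
    then show ?thesis by (simp only: N_def S_def)
  qed
  finally show ?thesis .
qed

section \<open>Limit of the explicit sum\<close>

text \<open>The polynomials in \<open>x\<close> are the Touchard polynomials. Each series follows
  from the earlier ones by the shift k g(k) x^k / k! = x g(k) x^(k - 1) / (k - 1)!.\<close>

lemma exp_moment_sums:
  fixes x :: real
  shows "(\<lambda>k. x ^ k / fact k) sums exp x"
    and "(\<lambda>k. real k * (x ^ k / fact k)) sums (x * exp x)"
    and "(\<lambda>k. real k ^ 2 * (x ^ k / fact k)) sums ((x\<^sup>2 + x) * exp x)"
    and "(\<lambda>k. real k ^ 3 * (x ^ k / fact k)) sums ((x ^ 3 + 3 * x\<^sup>2 + x) * exp x)"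
proof -
  show 0: "(\<lambda>k. x ^ k / fact k) sums exp x"
    using exp_converges[of x] by (simp add: field_simps)
  have shift: "(\<lambda>k. real k * g k * (x ^ k / fact k)) sums (x * s)"
    if "(\<lambda>k. g (Suc k) * (x ^ k / fact k)) sums s" for g :: "nat \<Rightarrow> real" and s
  proof -
    have "(\<lambda>k. x * (g (Suc k) * (x ^ k / fact k))) sums (x * s)"
      using that by (rule sums_mult)
    moreover have "x * (g (Suc k) * (x ^ k / fact k)) = real (Suc k) * g (Suc k) *
        (x ^ Suc k / fact (Suc k))" for k
      by (simp add: field_simps del: of_nat_Suc)
    ultimately have "(\<lambda>k. real (Suc k) * g (Suc k) * (x ^ Suc k / fact (Suc k))) sums (x * s)"
      by (simp only:)
    then show ?thesis
      using sums_Suc[of "\<lambda>k. real k * g k * (x ^ k / fact k)"] by fastforce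
  qed
  show 1: "(\<lambda>k. real k * (x ^ k / fact k)) sums (x * exp x)"
    using shift[of "\<lambda>_. 1"] 0 by simp
  have "(\<lambda>k. real (Suc k) * (x ^ k / fact k)) sums (x * exp x + exp x)"
    using sums_add[OF 1 0] by (simp add: algebra_simps add_divide_distrib)
  from shift[OF this] show 2: "(\<lambda>k. real k ^ 2 * (x ^ k / fact k)) sums ((x\<^sup>2 + x) * exp x)"
    by (simp add: algebra_simps power2_eq_square)
  have "(\<lambda>k. real (Suc k) ^ 2 * (x ^ k / fact k)) sums ((x\<^sup>2 + x) * exp x + (2 * (x * exp x) +
      exp x))"
    using sums_add[OF 2 sums_add[OF sums_mult[OF 1, of 2] 0]]
    by (simp add: algebra_simps power2_eq_square add_divide_distrib)
  from shift[OF this] show "(\<lambda>k. real k ^ 3 * (x ^ k / fact k)) sums ((x ^ 3 + 3 * x\<^sup>2 + x) *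
      exp x)"
    by (simp add: algebra_simps power2_eq_square power3_eq_cube)
qed

text \<open>The series evaluates (2 x + 1) exp(x) at its zero x = -1/2.\<close>

lemma takacs_coeff_sums: "takacs_coeff sums 0"
  using sums_add[OF sums_mult[OF exp_moment_sums(2)[of "-1/2"], of 2] exp_moment_sums(1)[of "-1/2"]]
  by (simp add: takacs_coeff_def[abs_def] algebra_simps add_divide_distrib)

text \<open>Expansion of k (2 k + 1)^2 = 4 k^3 + 4 k^2 + k. The variable \<open>x\<close> stays
  general because x = -1/2 gives the limit and x = 1/2 the summable majorant.\<close>

lemma cubic_moment_sums:
  fixes x :: real
  shows "(\<lambda>k. x ^ k / fact k * real (2 * k + 1) * real (k * (2 * k + 1))) sums ((4 * x ^ 3 + 16 *
      x\<^sup>2 + 9 * x) * exp x)"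
  using sums_add[OF sums_mult[OF exp_moment_sums(4)[of x], of 4]
      sums_add[OF sums_mult[OF exp_moment_sums(3)[of x], of 4] exp_moment_sums(2)[of x]]]
  by (simp add: algebra_simps power2_eq_square power3_eq_cube add_divide_distrib)

lemma falling_ratio_tendsto:
  "(\<lambda>n. real (n + 1) * (falling_ratio n j - 1)) \<longlonglongrightarrow> - (\<Sum>i=1..j. real i)"
proof (induction j)
  case (Suc j)
  have "(\<lambda>n. 1 - real (Suc j) / real (n + 1)) \<longlonglongrightarrow> 1" by real_asymp
  from tendsto_diff[OF tendsto_mult[OF Suc.IH this] tendsto_const[of "real (Suc j)"]]
  have "(\<lambda>n. real (n + 1) * (falling_ratio n j - 1) * (1 - real (Suc j) / real (n +
      1)) - real (Suc j)) \<longlonglongrightarrow>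
     - (\<Sum>i=1..j. real i) * 1 - real (Suc j)" .
  also have "(\<lambda>n. real (n + 1) * (falling_ratio n j - 1) * (1 - real (Suc j) / real (n +
      1)) - real (Suc j)) =
    (\<lambda>n. real (n + 1) * (falling_ratio n (Suc j) - 1))"
    by (intro ext) (simp add: falling_ratio_Suc field_simps)
  also have "- (\<Sum>i=1..j. real i) * 1 - real (Suc j) = - (\<Sum>i=1..Suc j. real i)" by simp
  finally show ?case .
qed (simp add: falling_ratio_def)

lemma sum_1_to_double: "(\<Sum>i=1..2*k. real i) = real (k * (2 * k + 1))"
proof (induction k)
  case (Suc k)
  have "(\<Sum>i=1..2 * Suc k. real i) = (\<Sum>i=1..2*k. real i) + real (2 * k + 1) + real (2 * k + 2)"
      by simp
  then show ?case using Suc by (simp add: algebra_simps)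
qed auto

text \<open>The bound is uniform in \<open>n\<close>, as dominated convergence of the series
  requires. For 2 k \<le> n all factors lie between 0 and 1, so the product deviates from 1 by at
  most the sum of the deviations of the factors. Otherwise the product is zero and n + 1 \<le> 2
  k.\<close>

lemma falling_ratio_bound:
  "\<bar>real (n + 1) * (falling_ratio n (2 * k) - 1)\<bar> \<le> real (k * (2 * k + 1))"
proof (cases "2 * k \<le> n")
  case True
  have "\<bar>falling_ratio n (2 * k) - 1\<bar> \<le> (\<Sum>i=1..2*k. \<bar>(1 - real i / real (n + 1)) - 1\<bar>)"
    using norm_prod_diff[of "{1..2*k}" "\<lambda>i. 1 - real i / real (n + 1)" "\<lambda>_. 1"] True
    by (auto simp: falling_ratio_def abs_le_iff field_simps)
  also have "\<dots> = (\<Sum>i=1..2*k. real i) / real (n + 1)"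
    by (simp add: sum_divide_distrib)
  finally have "real (n + 1) * \<bar>falling_ratio n (2 * k) - 1\<bar> \<le> real (n + 1) *
      ((\<Sum>i=1..2*k. real i) / real (n + 1))"
    by (rule mult_left_mono) simp
  also have "\<dots> = real (k * (2 * k + 1))"
    by (subst sum_1_to_double) simp
  finally show ?thesis by (simp add: abs_mult)
next
  case False
  then have "n + 1 \<le> 2 * k" "k \<ge> 1" by auto
  moreover from \<open>k \<ge> 1\<close> have "k * 2 \<le> k * (2 * k + 1)" by (intro mult_left_mono) auto
  ultimately have "n + 1 \<le> k * (2 * k + 1)" by linarith
  then have "real (n + 1) \<le> real (k * (2 * k + 1))" using of_nat_mono by blast
  then show ?thesis using False by (simp add: falling_ratio_eq_0 del: of_nat_mult)
qed

text \<open>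
  As the coefficients \<open>takacs_coeff\<close> sum to zero, the leading order cancels and the limit comes from
  the first-order deviation of \<open>falling_ratio\<close> from one.
\<close>

lemma nforests_asymptotics:
  "(\<lambda>n. real (nforests n) * real (n + 1) ^ 2 / real (n + 1) ^ n) \<longlonglongrightarrow> exp (- 1/2)"
proof -
  define a where "a k n = takacs_coeff k * (real (n + 1) * (falling_ratio n (2 * k) - 1))" for k n
  define M where "M k = (1/2) ^ k / fact k * real (2 * k + 1) * real (k * (2 * k + 1))" for k :: nat
  have "(\<lambda>n. suminf (\<lambda>k. a k n)) \<longlonglongrightarrow> suminf (\<lambda>k. takacs_coeff k * - real (k * (2 * k + 1)))"
  proof (rule tannerys_theorem[THEN conjunct2, THEN conjunct2])
    show "(\<lambda>n. a k n) \<longlonglongrightarrow> takacs_coeff k * - real (k * (2 * k + 1))" for k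
      unfolding a_def sum_1_to_double[symmetric]
      by (intro tendsto_mult tendsto_const falling_ratio_tendsto)
    show "summable M"
      unfolding M_def using cubic_moment_sums by (rule sums_summable)
    have "norm (a k n) \<le> M k" for k n
    proof -
      have "norm (a k n) = norm (takacs_coeff k) * \<bar>real (n + 1) * (falling_ratio n (2 * k) - 1)\<bar>"
        by (simp add: a_def abs_mult)
      also have "\<dots> \<le> norm (takacs_coeff k) * real (k * (2 * k + 1))"
        by (intro mult_left_mono falling_ratio_bound) auto
      also have "\<dots> = M k"
        by (simp add: M_def takacs_coeff_def abs_mult power_abs del: of_nat_mult)
      finally show ?thesis .
    qed
    then show "\<forall>\<^sub>F (k, n) in sequentially \<times>\<^sub>F sequentially. norm (a k n) \<le> M k"
      by (simp add: always_eventually split_beta)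
  qed simp
  also have "suminf (\<lambda>k. takacs_coeff k * - real (k * (2 * k + 1))) = exp (- 1/2)"
  proof -
    have "(4 * (-1/2) ^ 3 + 16 * (-1/2)\<^sup>2 + 9 * (-1/2)) * exp (-1/2) = - exp (-1/2 :: real)"
      by (simp add: power2_eq_square power3_eq_cube)
    with sums_minus[OF cubic_moment_sums[of "-1/2"]]
    have "(\<lambda>k. takacs_coeff k * - real (k * (2 * k + 1))) sums exp (- 1/2)"
      by (simp only: takacs_coeff_def mult_minus_right minus_minus)
    then show ?thesis by (rule sums_unique[symmetric])
  qed
  also have "(\<lambda>n. suminf (\<lambda>k. a k n)) = (\<lambda>n. real (nforests n) * real (n + 1) ^ 2 / real (n +
      1) ^ n)"
  proof
    fix n
    \<comment> \<open>Subtracting \<open>takacs_coeff k\<close> from every term leaves the sum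
      unchanged, since these coefficients add up to zero.\<close>
    have "(\<lambda>k. real (n + 1) * (takacs_coeff k * falling_ratio n (2 * k) - takacs_coeff k)) sums
       (real (n + 1) * (real (nforests n) * real (n + 1) / real (n + 1) ^ n - 0))"
      by (intro sums_mult sums_diff nforests_eq_suminf takacs_coeff_sums)
    then show "suminf (\<lambda>k. a k n) = real (nforests n) * real (n + 1) ^ 2 / real (n + 1) ^ n"
      by (subst sums_unique[symmetric, OF _]) (auto simp: a_def algebra_simps power2_eq_square)
  qed
  finally show ?thesis .
qed

lemma nforests_pos: "eventually (\<lambda>n. nforests n > 0) at_top"
proof -
  have "eventually (\<lambda>n. real (nforests n) * real (n + 1) ^ 2 / real (n + 1) ^ n > 0) at_top"
    by (rule order_tendstoD(1)[OF nforests_asymptotics]) simp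
  then show ?thesis by eventually_elim (auto intro!: Nat.gr0I)
qed

section \<open>Ratios of forest numbers\<close>

lemma nforests_ratio:
  "(\<lambda>n. real (Suc n) * real (nforests n) / real (nforests (Suc n))) \<longlonglongrightarrow> exp (- 1)"
proof -
  define g where "g = (\<lambda>n. real (nforests n) * real (n + 1) ^ 2 / real (n + 1) ^ n)"
  have g: "g \<longlonglongrightarrow> exp (- 1/2)" unfolding g_def by (rule nforests_asymptotics)
  have "(\<lambda>n. g n / g (Suc n)) \<longlonglongrightarrow> exp (-1/2) / exp (-1/2)"
    by (intro tendsto_divide g LIMSEQ_Suc) auto
  \<comment> \<open>With N = n + 1 and M = n + 2 this is (N / M)^(n - 1), left in the shape in which
    it arises from \<open>g n / g (Suc n)\<close>.\<close>
  moreover have "(\<lambda>n. real (Suc n) ^ n * real (Suc n) / real (n + 1)^2 * real (n + 2)^2 / real (n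
      + 2) ^ Suc n) \<longlonglongrightarrow> exp (-1)"
    by (real_asymp simp: exp_minus)
  ultimately have "(\<lambda>n. g n / g (Suc n) * (real (Suc n) ^ n * real (Suc n) / real (n + 1)^2 *
      real (n + 2)^2 / real (n + 2) ^ Suc n)) \<longlonglongrightarrow> 1 * exp (-1)"
    by (intro tendsto_mult) auto
  also have "(\<lambda>n. g n / g (Suc n) * (real (Suc n) ^ n * real (Suc n) / real (n + 1)^2 * real (n +
      2)^2 / real (n + 2) ^ Suc n)) =
     (\<lambda>n. real (Suc n) * real (nforests n) / real (nforests (Suc n)))"
  proof
    fix n
    define N M where "N = real (Suc n)" and "M = real (n + 2)"
    have "N > 0" "M > 0" by (simp_all add: N_def M_def)
    moreover have "g n = real (nforests n) * N ^ 2 / N ^ n" "g (Suc n) = real (nforests (Suc n)) *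
        M ^ 2 / M ^ Suc n"
      by (simp_all add: g_def N_def M_def add.commute)
    moreover have "real (n + 1) = N" by (simp add: N_def)
    ultimately show "g n / g (Suc n) * (real (Suc n) ^ n * real (Suc n) / real (n + 1)^2 * real (n
        + 2)^2 / real (n + 2) ^ Suc n) =
      real (Suc n) * real (nforests n) / real (nforests (Suc n))"
      by (simp only: N_def[symmetric] M_def[symmetric]) (simp add: field_simps)
  qed
  finally show ?thesis by simp
qed

text \<open>The quotient is a product of \<open>k\<close> factors as in
  \<open>nforests_ratio\<close>, divided by k!. The induction step works at n + k, where no
  truncated subtraction interferes, and shifts back at the end.\<close>

lemma nforests_ratio_choose:
  "(\<lambda>n. real (n choose k) * real (nforests (n - k)) / real (nforests n)) \<longlonglongrightarrow> exp (- real k) / fact k"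
proof (induction k)
  case 0
  have "eventually (\<lambda>n. 1 = real (nforests n) / real (nforests n)) at_top"
    using nforests_pos by eventually_elim auto
  then show ?case by (simp add: tendsto_eventually eventually_mono)
next
  case (Suc k)
  have "(\<lambda>n. real (n + k choose k) * real (nforests (n + k - k)) / real (nforests (n + k)))
      \<longlonglongrightarrow> exp (- real k) / fact k"
    using Suc.IH by (rule LIMSEQ_ignore_initial_segment)
  from LIMSEQ_Suc[OF this]
  have *: "(\<lambda>n. real (Suc n + k choose k) * real (nforests (Suc n)) / real (nforests (Suc n + k)))
      \<longlonglongrightarrow> exp (- real k) / fact k"
    by simp
  have "(\<lambda>n. real (Suc n) * real (nforests n) / real (nforests (Suc n)) *
     (real (Suc n + k choose k) * real (nforests (Suc n)) / real (nforests (Suc n +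
         k))) / real (Suc k))
      \<longlonglongrightarrow> exp (- 1) * (exp (- real k) / fact k) / real (Suc k)"
    by (rule tendsto_divide[OF tendsto_mult[OF nforests_ratio
        *] tendsto_const]) (simp del: of_nat_Suc)
  also have "exp (- 1) * (exp (- real k) / fact k) / real (Suc k) =
      exp (- real (Suc k)) / fact (Suc k)"
    by (simp add: mult_exp_exp field_simps del: of_nat_Suc)
  finally have "(\<lambda>n. real (n + Suc k choose Suc k) * real (nforests (n +
      Suc k - Suc k)) / real (nforests (n + Suc k)))
      \<longlonglongrightarrow> exp (- real (Suc k)) / fact (Suc k)"
  proof (rule Lim_transform_eventually)
    have "eventually (\<lambda>n. nforests (Suc n) > 0) at_top"
      using nforests_pos eventually_sequentially_Suc[of "\<lambda>n. nforests n > 0"] by simp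
    then show "\<forall>\<^sub>F n in sequentially. real (Suc n) * real (nforests n) / real (nforests (Suc n)) *
       (real (Suc n + k choose k) * real (nforests (Suc n)) / real (nforests (Suc n +
           k))) / real (Suc k) =
       real (n + Suc k choose Suc k) * real (nforests (n + Suc k - Suc k)) / real (nforests (n +
           Suc k))"
    proof eventually_elim
      case (elim n)
      have "Suc k * (Suc n + k choose Suc k) = Suc n * (Suc n + k choose k)"
        using Suc_times_binomial_add[of k n] by (simp only: add_Suc add.commute[of n k])
      then have "real (Suc k) * real (Suc n + k choose Suc k) = real (Suc n) * real (Suc n +
          k choose k)"
        by (metis of_nat_mult)
      then have "real (Suc n + k choose Suc k) = real (Suc n) * real (Suc n +
          k choose k) / real (Suc k)"
        by (simp add: field_simps del: of_nat_Suc binomial_Suc_Suc)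
      then show ?case using elim by (simp add: mult_ac del: of_nat_Suc binomial_Suc_Suc)
    qed
  qed
  then show ?case by (rule LIMSEQ_offset)
qed

text \<open>The order (n + 1)^(n - 2) of the forest numbers beats every exponential. This makes the
  forests without a large matching negligible.\<close>

lemma exp_over_nforests:
  fixes C :: real
  assumes "C > 0"
  shows "(\<lambda>n. C ^ n / real (nforests n)) \<longlonglongrightarrow> 0"
proof -
  have "(\<lambda>n. C ^ n * real (n + 1) ^ 2 / real (n + 1) ^ n) \<longlonglongrightarrow> 0"
  proof (rule tendsto_sandwich[of "\<lambda>_. 0"])
    show "(\<lambda>n. (1/2) ^ n * real (n + 1) ^ 2) \<longlonglongrightarrow> 0" by real_asymp
    have "eventually (\<lambda>n. 2 * C \<le> real (n + 1)) at_top" by real_asymp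
    then show "\<forall>\<^sub>F n in sequentially. C ^ n * real (n + 1) ^ 2 / real (n + 1) ^ n \<le> (1/2) ^ n *
        real (n + 1) ^ 2"
    proof eventually_elim
      case (elim n)
      have "C ^ n / real (n + 1) ^ n = (C / real (n + 1)) ^ n" by (simp add: power_divide)
      also have "\<dots> \<le> (1/2) ^ n"
        using elim assms by (intro power_mono) (auto simp: field_simps)
      finally have "C ^ n / real (n + 1) ^ n * real (n + 1) ^ 2 \<le> (1/2) ^ n * real (n + 1) ^ 2"
        by (intro mult_right_mono) auto
      then show ?case by (simp add: mult.commute mult.left_commute)
    qed
  qed (use assms in \<open>auto intro!: always_eventually simp del: of_nat_Suc of_nat_add\<close>)
  from tendsto_divide[OF this nforests_asymptotics]
  have "(\<lambda>n. (C ^ n * real (n + 1) ^ 2 / real (n + 1) ^ n) / (real (nforests n) * real (n +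
      1) ^ 2 / real (n + 1) ^ n)) \<longlonglongrightarrow> 0"
    by simp
  then show ?thesis by (simp add: field_simps)
qed

section \<open>Asymptotic number of graphs with a small blocker\<close>

lemma card_split_subsets:
  assumes "P \<inter> C = {}" "\<F> \<subseteq> Pow P" "\<D> \<subseteq> Pow C"
  shows "card {E. E \<subseteq> P \<union> C \<and> E \<inter> P \<in> \<F> \<and> E \<inter> C \<in> \<D>} = card \<F> * card \<D>"
proof -
  have inter: "(F \<union> D) \<inter> P = F" "(F \<union> D) \<inter> C = D" if "F \<in> \<F>" "D \<in> \<D>" for F D
    using assms that by blast+
  have "bij_betw (\<lambda>E. (E \<inter> P, E \<inter> C)) {E. E \<subseteq> P \<union> C \<and> E \<inter> P \<in> \<F> \<and> E \<inter> C \<in> \<D>} (\<F> \<times> \<D>)"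
  proof (rule bij_betwI[where g = "\<lambda>(F, D). F \<union> D"])
    show "(\<lambda>(F, D). F \<union> D) \<in> \<F> \<times> \<D> \<rightarrow> {E. E \<subseteq> P \<union> C \<and> E \<inter> P \<in> \<F> \<and> E \<inter> C \<in> \<D>}"
      using assms inter by auto
    show "(\<lambda>E. (E \<inter> P, E \<inter> C)) (case y of (F, D) \<Rightarrow> F \<union> D) = y" if "y \<in> \<F> \<times> \<D>" for y
      using that by (cases y) (simp add: inter)
  qed auto
  then show ?thesis by (simp add: bij_betw_same_card flip: card_cartesian_product)
qed

text \<open>On each of the disjoint pairs three of the four possible traces are allowed,
  independently of the others, so a fraction (3/4)^p of all subsets remains for p pairs.
  Denominators are cleared to stay within the naturals.\<close>

lemma card_avoiding_pairs:
  assumes "finite Y" "finite \<P>" "\<And>P. P \<in> \<P> \<Longrightarrow> P \<subseteq> Y \<and> card P = 2"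
    and "\<And>P Q. P \<in> \<P> \<Longrightarrow> Q \<in> \<P> \<Longrightarrow> P \<noteq> Q \<Longrightarrow> P \<inter> Q = {}"
  shows "card {D. D \<subseteq> Y \<and> (\<forall>P\<in>\<P>. \<not> P \<subseteq> D)} * 4 ^ card \<P> = 3 ^ card \<P> * 2 ^ card Y"
  using assms(2,1,3,4)
proof (induction \<P> arbitrary: Y rule: finite_induct)
  case empty
  then show ?case by (simp add: card_Pow flip: Pow_def)
next
  case (insert P \<P>)
  let ?g = "\<lambda>\<P> Y. {D. D \<subseteq> Y \<and> (\<forall>P\<in>\<P>. \<not> P \<subseteq> D)}"
  have P: "P \<subseteq> Y" "card P = 2" "finite P"
    using insert.prems(2)[of P] by (auto intro: card_ge_0_finite)
  have disj: "P \<inter> Q = {}" if "Q \<in> \<P>" for Q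
    using insert.prems(3)[of P Q] insert.hyps that by auto
  have IH: "card (?g \<P> (Y - P)) * 4 ^ card \<P> = 3 ^ card \<P> * 2 ^ card (Y - P)"
  proof (rule insert.IH)
    show "Q \<subseteq> Y - P \<and> card Q = 2" if "Q \<in> \<P>" for Q
      using insert.prems(2)[of Q] disj[OF that] that by auto
  qed (use insert.prems in auto)
  have "?g (insert P \<P>) Y = {E. E \<subseteq> P \<union> (Y - P) \<and> E \<inter> P \<in> Pow P - {P} \<and> E \<inter> (Y - P) \<in> ?g \<P> (Y - P)}"
    (is "_ = ?R")
  proof (intro set_eqI iffI)
    fix D assume D: "D \<in> ?g (insert P \<P>) Y"
    then show "D \<in> ?R" by auto
  next
    fix D assume D: "D \<in> ?R"
    have "\<not> Q \<subseteq> D" if "Q \<in> \<P>" for Q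
    proof
      assume "Q \<subseteq> D"
      moreover have "Q \<subseteq> Y - P" using insert.prems(2)[of Q] disj[OF that] that by auto
      ultimately have "Q \<subseteq> D \<inter> (Y - P)" by simp
      with D that show False by blast
    qed
    with D P(1) show "D \<in> ?g (insert P \<P>) Y" by auto
  qed
  also have "card ?R = card (Pow P - {P}) * card (?g \<P> (Y - P))"
    by (rule card_split_subsets) auto
  also have "card (Pow P - {P}) = 3"
    using P by (simp add: card_Diff_subset card_Pow)
  finally have "card (?g (insert P \<P>) Y) = 3 * card (?g \<P> (Y - P))" .
  moreover have "card Y = card (Y - P) + 2"
    using P insert.prems(1) card_mono[of Y P] by (simp add: card_Diff_subset)
  ultimately show ?case using IH insert.hyps by (simp add: power_add)
qed

section \<open>Graphs with a prescribed blocker\<close>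

definition near_forests :: "'a set \<Rightarrow> 'a set \<Rightarrow> 'a set set set" where
  "near_forests V S = {E. E \<subseteq> pairs V \<and> acyc (V - S) E}"

definition cross :: "'a set \<Rightarrow> 'a set \<Rightarrow> 'a set set" where
  "cross V S = pairs V - pairs (V - S)"

text \<open>Graphs with a vertex cover of at most \<open>c\<close> vertices. They include the graphs
  without a large matching and are easy to count.\<close>

definition covered :: "nat \<Rightarrow> 'a set \<Rightarrow> 'a set set set" where
  "covered c W = {F. F \<subseteq> pairs W \<and> (\<exists>C\<subseteq>W. card C \<le> c \<and> (\<forall>e\<in>F. e \<inter> C \<noteq> {}))}"

definition ambiguous :: "'a set \<Rightarrow> 'a set \<Rightarrow> 'a set set set" where
  "ambiguous V S = {E \<in> near_forests V S. \<exists>S'\<subseteq>V. card S' = card S \<and> S' \<noteq> S \<and> E \<in> near_forests V S'}"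

lemma finite_near_forests [simp]: "finite V \<Longrightarrow> finite (near_forests V S)"
  unfolding near_forests_def by (rule finite_subset[of _ "Pow (pairs V)"]) auto

lemma pairs_eq_Un_cross: "pairs V = pairs (V - S) \<union> cross V S"
  using pairs_mono[of "V - S" V] by (auto simp: cross_def)

lemma card_cross:
  assumes "finite V" "S \<subseteq> V"
  shows "card (cross V S) = card S * (card V - card S) + (card S choose 2)"
proof -
  have fin: "finite S" using assms finite_subset by auto
  define d where "d = card V - card S"
  have V: "card V = d + card S" using assms by (simp add: d_def card_mono)
  have "card (cross V S) = (card V choose 2) - (d choose 2)"
    unfolding cross_def using assms fin n_subsets[of V 2] n_subsets[of "V - S" 2] pairs_mono[of "V
        - S" V]
    by (subst card_Diff_subset) (auto simp: pairs_def card_Diff_subset d_def)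
  also have "card V choose 2 = (d choose 2) + d * card S + (card S choose 2)"
  proof -
    have "(d + s) choose 2 = (d choose 2) + d * s + (s choose 2)" for s
      by (induction s) (auto simp: numeral_2_eq_2)
    then show ?thesis by (simp add: V)
  qed
  finally show ?thesis by (simp add: d_def)
qed

lemma card_near_forests:
  assumes "finite V" "S \<subseteq> V"
  shows "card (near_forests V S) = nforests (card V - card S) * 2 ^ card (cross V S)"
proof -
  have "near_forests V S = {E. E \<subseteq> pairs (V - S) \<union> cross V S \<and>
      E \<inter> pairs (V - S) \<in> forest_on (V - S) \<and> E \<inter> cross V S \<in> Pow (cross V S)}"
    using acyc_Int_pairs[of "V - S"] pairs_eq_Un_cross[of V S]
    by (auto simp: near_forests_def forest_on_def)
  also have "card \<dots> = card (forest_on (V - S)) * card (Pow (cross V S))"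
    by (rule card_split_subsets) (auto simp: cross_def forest_on_def)
  also have "\<dots> = nforests (card V - card S) * 2 ^ card (cross V S)"
    using assms by (simp add: card_forest_on card_Diff_subset finite_subset card_Pow cross_def)
  finally show ?thesis .
qed

text \<open>There are at most 2^|W| choices for the cover, and once it is fixed only the at most c
  |W| pairs meeting it can occur as edges.\<close>

lemma card_covered_le:
  assumes "finite W"
  shows "card (covered c W) \<le> 2 ^ ((c + 1) * card W)"
proof -
  let ?T = "\<lambda>C. {e \<in> pairs W. e \<inter> C \<noteq> {}}"
  have "covered c W \<subseteq> (\<Union>C\<in>{C. C \<subseteq> W \<and> card C \<le> c}. Pow (?T C))"
    by (auto simp: covered_def)
  then have "card (covered c W) \<le> card (\<Union>C\<in>{C. C \<subseteq> W \<and> card C \<le> c}. Pow (?T C))"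
    using assms by (intro card_mono) auto
  also have "\<dots> \<le> (\<Sum>C\<in>{C. C \<subseteq> W \<and> card C \<le> c}. card (Pow (?T C)))"
    using assms by (intro card_UN_le) auto
  also have "\<dots> \<le> (\<Sum>C\<in>{C. C \<subseteq> W \<and> card C \<le> c}. 2 ^ (c * card W))"
  proof (rule sum_mono)
    fix C assume C: "C \<in> {C. C \<subseteq> W \<and> card C \<le> c}"
    have "?T C \<subseteq> (\<lambda>(u, v). {u, v}) ` (C \<times> W)"
    proof
      fix e assume e: "e \<in> ?T C"
      then obtain u v where "e = {u, v}" "u \<in> W" "v \<in> W" by (blast elim: pairs_cases)
      with e show "e \<in> (\<lambda>(u, v). {u, v}) ` (C \<times> W)"
        by (auto intro: rev_image_eqI[of "(u, v)"] rev_image_eqI[of "(v, u)"])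
    qed
    moreover have "finite (C \<times> W)" using C assms by (auto intro: finite_subset)
    ultimately have "card (?T C) \<le> card (C \<times> W)"
      by (meson card_image_le card_mono finite_imageI le_trans)
    also have "\<dots> \<le> c * card W" using C by (simp add: card_cartesian_product)
    finally show "card (Pow (?T C)) \<le> 2 ^ (c * card W)"
      using assms by (simp add: card_Pow)
  qed
  also have "\<dots> \<le> 2 ^ card W * 2 ^ (c * card W)"
    using assms card_mono[of "Pow W" "{C. C \<subseteq> W \<and> card C \<le> c}"] by (auto simp: card_Pow)
  finally show ?thesis by (simp add: power_add algebra_simps)
qed

text \<open>The endpoints of an inclusion-maximal matching form a vertex cover, so a maximal
  matching with fewer than \<open>m\<close> edges would yield a cover of size at most
  \<open>2 * m\<close>.\<close>

lemma exists_large_matching: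
  assumes "finite W" "F \<subseteq> pairs W" "F \<notin> covered (2 * m) W"
  obtains M where "M \<subseteq> F" "m \<le> card M" "\<And>e e'. e \<in> M \<Longrightarrow> e' \<in> M \<Longrightarrow> e \<noteq> e' \<Longrightarrow> e \<inter> e' = {}"
proof -
  define Q where "Q = {M. M \<subseteq> F \<and> (\<forall>e\<in>M. \<forall>e'\<in>M. e \<noteq> e' \<longrightarrow> e \<inter> e' = {})}"
  have finF: "finite F" using assms by (auto intro: finite_subset)
  then have "finite Q" by (auto simp: Q_def)
  moreover have "{} \<in> Q" by (auto simp: Q_def)
  ultimately obtain M where M: "M \<in> Q" "\<And>M'. M' \<in> Q \<Longrightarrow> M \<subseteq> M' \<Longrightarrow> M' = M"
    by (metis finite_has_maximal empty_iff)
  have "m \<le> card M"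
  proof (rule ccontr)
    assume *: "\<not> m \<le> card M"
    have "card (\<Union> M) \<le> (\<Sum>e\<in>M. card e)" by (rule card_Union_le_sum_card)
    also have "\<dots> = (\<Sum>e\<in>M. 2)"
      using M(1) assms by (intro sum.cong) (auto simp: Q_def pairs_def)
    finally have "card (\<Union> M) \<le> 2 * m" using * by simp
    moreover have "\<Union> M \<subseteq> W" using M(1) assms by (auto simp: Q_def pairs_def)
    moreover have "e \<inter> \<Union> M \<noteq> {}" if e: "e \<in> F" for e
    proof
      assume d: "e \<inter> \<Union> M = {}"
      have "e \<inter> e' = {}" "e' \<inter> e = {}" if "e' \<in> M" for e'
        using d that by blast+
      then have "insert e M \<in> Q" using M(1) e unfolding Q_def by (simp add: ball_conj_distrib)
      then have "e \<in> M" using M(2)[of "insert e M"] by blast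
      moreover have "e \<noteq> {}" using assms e by (auto simp: pairs_def)
      ultimately show False using d by blast
    qed
    ultimately show False using assms by (auto simp: covered_def)
  qed
  with M(1) that show ?thesis by (auto simp: Q_def)
qed

lemma triangle_not_acyc:
  assumes "acyc X E" "{a, b} \<in> E" "{s, a} \<in> E" "{s, b} \<in> E" "{a, b, s} \<subseteq> X" "a \<noteq> b" "s \<noteq> a" "s \<noteq> b"
  shows False
proof -
  obtain v where v: "v \<in> {a, b, s}" "card (nbrs E {a, b, s} v) \<le> 1"
    using assms(1,5) unfolding acyc_def by blast
  moreover have "nbrs E {a, b, s} v = {a, b, s} - {v}"
  proof -
    have "{b, a} \<in> E" "{a, s} \<in> E" "{b, s} \<in> E" using assms(2-4) by (simp_all add: insert_commute)
    then show ?thesis using v(1) assms(2-4,6-) unfolding nbrs_def by blast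
  qed
  moreover have "card ({a, b, s} - {v}) = 2" using v(1) assms(6-) by auto
  ultimately show False by simp
qed

text \<open>
  A matching of the forest outside \<open>S\<close> is cut into \<open>k + 1\<close> blocks of \<open>r\<close> edges. Another blocker
  \<open>S'\<close> of size \<open>k\<close> misses some block entirely, and then a vertex of \<open>S - S'\<close> forms no triangle with
  any of the \<open>r\<close> edges of that block.
\<close>

lemma card_ambiguous_le:
  fixes V S :: "'a set" and k r :: nat
  assumes V: "finite V" "S \<subseteq> V" and k: "card S = k"
  defines "X \<equiv> card (cross V S)" and "N \<equiv> card V - k" and "c \<equiv> 2 * ((k + 1) * r)"
  shows "real (card (ambiguous V S)) \<le>
     2 ^ X * (2 ^ ((c + 1) * N) + real (nforests N) * (real (k * (k + 1)) * (3/4) ^ r))"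
proof -
  define W where "W = V - S"
  have fin: "finite W" "finite S" "finite (cross V S)"
    using V finite_subset by (auto simp: W_def cross_def)
  then have N: "card W = N"
    using V k by (simp add: W_def N_def card_Diff_subset)
  have split: "pairs V = pairs W \<union> cross V S" "pairs W \<inter> cross V S = {}"
    using pairs_eq_Un_cross[of V S] by (auto simp: W_def cross_def)
  define G where "G = forest_on W - covered c W"
  have "\<exists>h. h ` ({..k} \<times> {..<r}) \<subseteq> F \<and> inj_on h ({..k} \<times> {..<r}) \<and>
     (\<forall>i\<in>{..k} \<times> {..<r}. \<forall>j\<in>{..k} \<times> {..<r}. i \<noteq> j \<longrightarrow> h i \<inter> h j = {})" if F: "F \<in> G" for F
  proof -
    have F': "F \<subseteq> pairs W" "F \<notin> covered (2 * ((k + 1) * r)) W"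
      using F by (auto simp: G_def c_def forest_on_def)
    obtain M where M: "M \<subseteq> F" "(k + 1) * r \<le> card M"
      "\<And>e e'. e \<in> M \<Longrightarrow> e' \<in> M \<Longrightarrow> e \<noteq> e' \<Longrightarrow> e \<inter> e' = {}"
      by (rule exists_large_matching[OF fin(1) F']) blast
    moreover have "finite M" using M(1) F'(1) fin(1) by (meson finite_pairs finite_subset)
    ultimately obtain h where h: "h ` ({..k} \<times> {..<r}) \<subseteq> M" "inj_on h ({..k} \<times> {..<r})"
      using card_le_inj[of "{..k} \<times> {..<r}" M] by (auto simp: card_cartesian_product)
    show ?thesis
    proof (intro exI[of _ h] conjI h(2) ballI impI)
      fix i j assume "i \<in> {..k} \<times> {..<r}" "j \<in> {..k} \<times> {..<r}" "i \<noteq> j"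
      then show "h i \<inter> h j = {}"
        using h by (intro M(3)) (auto dest: inj_onD)
    qed (use h M in auto)
  qed
  \<comment> \<open>The matching is chosen from \<open>F\<close> alone. The edges at
    \<open>S\<close> therefore remain free for fixed \<open>F\<close> and can be counted.\<close>
  then obtain h where h: "\<And>F. F \<in> G \<Longrightarrow> h F ` ({..k} \<times> {..<r}) \<subseteq> F"
      "\<And>F. F \<in> G \<Longrightarrow> inj_on (h F) ({..k} \<times> {..<r})"
      "\<And>F i j. F \<in> G \<Longrightarrow> i \<in> {..k} \<times> {..<r} \<Longrightarrow> j \<in> {..k} \<times> {..<r} \<Longrightarrow> i \<noteq> j \<Longrightarrow> h F i \<inter> h F j = {}"
    by metis
  \<comment> \<open>\<open>\<P> F s b\<close> collects, for each matching edge of block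
    \<open>b\<close>, the two edges from \<open>s\<close> that would close a triangle with
    it.\<close>
  define \<P> where "\<P> F s b = (\<lambda>i. (\<lambda>a. {s, a}) ` h F (b, i)) ` {..<r}" for F s b
  define D where "D F s b = {D. D \<subseteq> cross V S \<and> (\<forall>P\<in>\<P> F s b. \<not> P \<subseteq> D)}" for F s b
  define T where "T F s b = {E. E \<subseteq> pairs W \<union> cross V S \<and> E \<inter> pairs W \<in> {F} \<and> E \<inter> cross V S \<in> D F
      s b}" for F s b
  \<comment> \<open>The exceptional graphs: their forest part has a small vertex cover, so no large
    matching is guaranteed.\<close>
  define B1 where "B1 = {E. E \<subseteq> pairs W \<union> cross V S \<and> E \<inter> pairs W \<in> covered c W \<and> E \<inter> cross V S \<in>
      Pow (cross V S)}"
  have card_T: "real (card (T F s b)) \<le> 2 ^ X * (3/4) ^ r" if "F \<in> G" "s \<in> S" "b \<le> k" for F s b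
  proof -
    have hp: "h F (b, i) \<in> pairs W" if "i < r" for i
      using h(1)[OF \<open>F \<in> G\<close>] \<open>F \<in> G\<close> \<open>b \<le> k\<close> that by (auto simp: G_def forest_on_def)
    have sW: "s \<notin> W" using \<open>s \<in> S\<close> by (auto simp: W_def)
    have inj: "inj_on (\<lambda>a. {s, a}) W" using sW by (auto simp: inj_on_def doubleton_eq_iff)
    have dis: "(\<lambda>a. {s, a}) ` h F (b, i) \<inter> (\<lambda>a. {s, a}) ` h F (b, j) = {}"
        if "i < r" "j < r" "i \<noteq> j" for i j
    proof -
      have "h F (b, i) \<inter> h F (b, j) = {}" using that \<open>F \<in> G\<close> \<open>b \<le> k\<close> by (intro h(3)) auto
      moreover have "h F (b, i) \<subseteq> W" "h F (b, j) \<subseteq> W" using hp that by (auto simp: pairs_def)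
      ultimately show ?thesis using inj_on_image_Int[OF inj, of "h F (b, i)" "h F (b, j)"] by simp
    qed
    have c2: "card ((\<lambda>a. {s, a}) ` h F (b, i)) = 2" if "i < r" for i
      using hp[OF that] inj by (subst card_image) (auto simp: pairs_def intro: inj_on_subset)
    have "inj_on (\<lambda>i. (\<lambda>a. {s, a}) ` h F (b, i)) {..<r}"
    proof (rule inj_onI, rule ccontr)
      fix i j assume "i \<in> {..<r}" "j \<in> {..<r}" "(\<lambda>a. {s, a}) ` h F (b, i) =
          (\<lambda>a. {s, a}) ` h F (b, j)" "i \<noteq> j"
      then show False using dis[of i j] c2[of i] by auto
    qed
    then have cP: "card (\<P> F s b) = r" by (simp add: \<P>_def card_image)
    have "card (D F s b) * 4 ^ card (\<P> F s b) = 3 ^ card (\<P> F s b) * 2 ^ card (cross V S)"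
      unfolding D_def
    proof (rule card_avoiding_pairs)
      fix P assume "P \<in> \<P> F s b"
      then obtain i where i: "i < r" "P = (\<lambda>a. {s, a}) ` h F (b, i)" by (auto simp: \<P>_def)
      have "{s, a} \<in> cross V S" if "a \<in> W" for a
        using that \<open>s \<in> S\<close> V by (auto simp: cross_def W_def)
      moreover have "h F (b, i) \<subseteq> W" using hp[OF i(1)] by (auto simp: pairs_def)
      ultimately show "P \<subseteq> cross V S \<and> card P = 2" using c2 i by auto
    next
      fix P Q assume PQ: "P \<in> \<P> F s b" "Q \<in> \<P> F s b" "P \<noteq> Q"
      then obtain i j where "i < r" "P = (\<lambda>a. {s, a}) ` h F (b, i)" "j < r" "Q =
          (\<lambda>a. {s, a}) ` h F (b, j)"
        by (auto simp: \<P>_def)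
      moreover from this PQ(3) have "i \<noteq> j" by blast
      ultimately show "P \<inter> Q = {}" using dis by simp
    qed (use fin in \<open>auto simp: \<P>_def\<close>)
    then have "real (card (D F s b) * 4 ^ r) = real (3 ^ r * 2 ^ X)"
      unfolding cP X_def by (rule arg_cong)
    then have "real (card (D F s b)) * 4 ^ r = 3 ^ r * 2 ^ X" by simp
    then have "real (card (D F s b)) = 2 ^ X * (3/4) ^ r"
      by (simp add: field_simps power_divide)
    moreover have "card (T F s b) = card {F} * card (D F s b)"
      unfolding T_def using split \<open>F \<in> G\<close>
      by (intro card_split_subsets) (auto simp: G_def forest_on_def D_def)
    ultimately show ?thesis by simp
  qed
  have "ambiguous V S \<subseteq> B1 \<union> (\<Union>(F, s, b)\<in>G \<times> S \<times> {..k}. T F s b)"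
  proof
    fix E assume E: "E \<in> ambiguous V S"
    then obtain S' where S': "S' \<subseteq> V" "card S' = k" "S' \<noteq> S" "acyc (V - S') E"
      and E': "E \<subseteq> pairs V" "acyc W E"
      by (auto simp: ambiguous_def near_forests_def k W_def)
    define F where "F = E \<inter> pairs W"
    have FW: "F \<in> forest_on W" using E' acyc_Int_pairs[of W E] by (auto simp: F_def forest_on_def)
    show "E \<in> B1 \<union> (\<Union>(F, s, b)\<in>G \<times> S \<times> {..k}. T F s b)"
    proof (cases "F \<in> covered c W")
      case True
      then show ?thesis using E' split by (auto simp: B1_def F_def)
    next
      case False
      with FW have FG: "F \<in> G" by (auto simp: G_def)
      have "finite S'" using S' V finite_subset by auto
      then have "\<not> S \<subseteq> S'" using S' k card_subset_eq by metis
      then obtain s where s: "s \<in> S" "s \<notin> S'" by auto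
      \<comment> \<open>Pigeonhole: if each of the \<open>k + 1\<close> disjoint blocks met
        \<open>S'\<close>, then \<open>S'\<close> would have more than \<open>k\<close>
        elements.\<close>
      have "\<exists>b\<le>k. \<forall>i<r. h F (b, i) \<inter> S' = {}"
      proof (rule ccontr)
        assume "\<not> ?thesis"
        then have "\<forall>b. \<exists>i x. b \<le> k \<longrightarrow> i < r \<and> x \<in> h F (b, i) \<inter> S'" by blast
        then obtain i x where ix: "\<And>b. b \<le> k \<Longrightarrow> i b < r \<and> x b \<in> h F (b, i b) \<inter> S'" by metis
        have "inj_on x {..k}"
        proof (rule inj_onI, rule ccontr)
          fix b b' assume "b \<in> {..k}" "b' \<in> {..k}" "x b = x b'" "b \<noteq> b'"
          then show False using ix[of b] ix[of b'] h(3)[OF FG, of "(b, i b)" "(b', i b')"] by auto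
        qed
        moreover have "x ` {..k} \<subseteq> S'" using ix by auto
        ultimately have "card {..k} \<le> card S'"
          using \<open>finite S'\<close> by (metis card_inj_on_le)
        then show False using S' by simp
      qed
      then obtain b where b: "b \<le> k" "\<And>i. i < r \<Longrightarrow> h F (b, i) \<inter> S' = {}" by blast
      have "\<not> P \<subseteq> E \<inter> cross V S" if P: "P \<in> \<P> F s b" for P
      proof
        assume PE: "P \<subseteq> E \<inter> cross V S"
        obtain i where i: "i < r" "P = (\<lambda>a. {s, a}) ` h F (b, i)" using P by (auto simp: \<P>_def)
        have hF: "h F (b, i) \<in> F" using h(1)[OF FG] i b by auto
        then have "h F (b, i) \<in> pairs W" by (simp add: F_def)
        then obtain x y where xy: "h F (b, i) = {x, y}" "x \<in> W" "y \<in> W" "x \<noteq> y"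
          by (elim pairs_cases)
        show False
        proof (rule triangle_not_acyc[OF S'(4), of x y s])
          show "{x, y, s} \<subseteq> V - S'" using xy s b(2)[OF i(1)] V by (auto simp: W_def)
        qed (use xy s PE i hF in \<open>auto simp: W_def F_def\<close>)
      qed
      then have "E \<in> T F s b" using E' split by (auto simp: T_def D_def F_def)
      then show ?thesis using FG s b by auto
    qed
  qed
  moreover have fB1: "finite B1" unfolding B1_def
    by (rule finite_subset[of _ "Pow (pairs W \<union> cross V S)"]) (use fin in auto)
  moreover have fT: "finite (T F s b)" for F s b unfolding T_def
    by (rule finite_subset[of _ "Pow (pairs W \<union> cross V S)"]) (use fin in auto)
  moreover have fG: "finite G" using fin by (auto simp: G_def)
  ultimately have "card (ambiguous V S) \<le> card (B1 \<union> (\<Union>(F, s, b)\<in>G \<times> S \<times> {..k}. T F s b))"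
    using fin by (intro card_mono) (auto simp: split_beta)
  also have "\<dots> \<le> card B1 + card (\<Union>(F, s, b)\<in>G \<times> S \<times> {..k}. T F s b)"
    by (rule card_Un_le)
  also have "\<dots> \<le> card B1 + (\<Sum>(F, s, b)\<in>G \<times> S \<times> {..k}. card (T F s b))"
    using fG fin by (simp add: split_beta card_UN_le)
  finally have "real (card (ambiguous V S)) \<le> real (card B1) +
      (\<Sum>(F, s, b)\<in>G \<times> S \<times> {..k}. real (card (T F s b)))"
    by (simp add: split_beta flip: of_nat_sum of_nat_add)
  also have "(\<Sum>(F, s, b)\<in>G \<times> S \<times> {..k}. real (card (T F s b))) \<le> real (card (G \<times> S \<times> {..k})) *
      (2 ^ X * (3/4) ^ r)"
    by (rule sum_bounded_above) (auto intro: card_T)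
  also have "\<dots> = real (card G) * (real (k * (k + 1)) * (2 ^ X * (3/4) ^ r))"
    by (simp add: card_cartesian_product k)
  also have "\<dots> \<le> real (nforests N) * (real (k * (k + 1)) * (2 ^ X * (3/4) ^ r))"
  proof (rule mult_right_mono)
    have "card G \<le> card (forest_on W)" using fin by (intro card_mono) (auto simp: G_def)
    then show "real (card G) \<le> real (nforests N)" using fin by (simp add: card_forest_on N)
  qed simp
  also have "card B1 = card (covered c W) * card (Pow (cross V S))"
    unfolding B1_def using split by (intro card_split_subsets) (auto simp: covered_def)
  also have "real \<dots> \<le> 2 ^ ((c + 1) * N) * 2 ^ X"
  proof -
    have "card (covered c W) * card (Pow (cross V S)) \<le> 2 ^ ((c + 1) * N) * 2 ^ X"
      using card_covered_le[OF fin(1), of c] fin by (simp add: card_Pow X_def N)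
    then have "real (card (covered c W) * card (Pow (cross V S))) \<le> real (2 ^ ((c + 1) * N) *
        2 ^ X)"
      by (rule of_nat_mono)
    then show ?thesis by simp
  qed
  finally show ?thesis by (simp add: algebra_simps)
qed

section \<open>Union over all blockers of the same size\<close>

text \<open>Requiring size exactly \<open>k\<close> makes all members of the union equally large
  when \<open>V\<close> is finite. For k \<le> |V| smaller blockers are still accounted for, since a
  blocker remains one when enlarged.\<close>

definition apex_sets :: "nat \<Rightarrow> 'a set \<Rightarrow> 'a set set set" where
  "apex_sets k V = (\<Union>S\<in>{S. S \<subseteq> V \<and> card S = k}. near_forests V S)"

text \<open>The upper bound is the union bound. For the lower one, removing the ambiguous graphs
  makes the sets \<open>near_forests V S\<close> disjoint, and \<open>Q\<close> adds up the estimate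
  of \<open>card_ambiguous_le\<close> over all \<open>S\<close>.\<close>

lemma card_apex_sets_bounds:
  fixes V :: "'a set" and k r :: nat
  assumes V: "finite V"
  defines "n \<equiv> card V"
  defines "P \<equiv> real (n choose k) * (real (nforests (n - k)) * 2 ^ (k * (n - k) + (k choose 2)))"
    and "Q \<equiv> real (n choose k) * (2 ^ (k * (n - k) + (k choose 2)) *
       (2 ^ ((2 * ((k + 1) * r) + 1) * (n - k)) + real (nforests (n - k)) * (real (k * (k + 1)) *
           (3/4) ^ r)))"
  shows "real (card (apex_sets k V)) \<le> P" and "P - Q \<le> real (card (apex_sets k V))"
proof -
  let ?I = "{S. S \<subseteq> V \<and> card S = k}"
  have fI: "finite ?I" and cI: "card ?I = n choose k"
    using V n_subsets[OF V, of k] by (auto simp: n_def)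
  have near: "real (card (near_forests V S)) = real (nforests (n - k)) * 2 ^ (k * (n - k) +
      (k choose 2))" if "S \<in> ?I" for S
    using that V by (simp add: card_near_forests card_cross n_def)
  have "real (card (apex_sets k V)) \<le> (\<Sum>S\<in>?I. real (card (near_forests V S)))"
    unfolding apex_sets_def using card_UN_le[OF fI, of "near_forests V"] by (simp flip: of_nat_sum)
  also have sumP: "\<dots> = P" using cI near by (simp add: P_def)
  finally show "real (card (apex_sets k V)) \<le> P" .
  have "(\<Sum>S\<in>?I. real (card (ambiguous V S))) \<le> real (card ?I) *  (2 ^ (k * (n - k) + (k choose 2)) *
       (2 ^ ((2 * ((k + 1) * r) + 1) * (n - k)) + real (nforests (n - k)) * (real (k * (k + 1)) *
           (3/4) ^ r)))"
  proof (rule sum_bounded_above)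
    fix S assume "S \<in> ?I"
    then show "real (card (ambiguous V S)) \<le>  (2 ^ (k * (n - k) + (k choose 2)) *
       (2 ^ ((2 * ((k + 1) * r) + 1) * (n - k)) + real (nforests (n - k)) * (real (k * (k + 1)) *
           (3/4) ^ r)))"
      using card_ambiguous_le[OF V, of S k r] V card_cross[OF V, of S] by (auto simp: n_def)
  qed
  then have "P - Q \<le> (\<Sum>S\<in>?I. real (card (near_forests V S))) - (\<Sum>S\<in>?I. real (card (ambiguous V S)))"
    using sumP cI by (simp add: Q_def)
  also have "\<dots> = (\<Sum>S\<in>?I. real (card (near_forests V S - ambiguous V S)))"
  proof -
    have "ambiguous V S \<subseteq> near_forests V S" for S by (auto simp: ambiguous_def)
    then have "real (card (near_forests V S - ambiguous V S)) =
        real (card (near_forests V S)) - real (card (ambiguous V S))" for S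
      using V by (metis card_Diff_subset card_mono finite_near_forests finite_subset of_nat_diff)
    then show ?thesis by (simp add: sum_subtractf)
  qed
  also have "\<dots> = real (card (\<Union>S\<in>?I. near_forests V S - ambiguous V S))"
    using fI V by (subst card_UN_disjoint) (auto simp: ambiguous_def)
  also have "\<dots> \<le> real (card (apex_sets k V))"
    using fI V unfolding apex_sets_def by (intro of_nat_mono card_mono) auto
  finally show "P - Q \<le> real (card (apex_sets k V))" .
qed

lemma card_apex_sets_asymptotics:
  "(\<lambda>n. real (card (apex_sets k {1..n})) / (2 ^ (k * n) * real (nforests n))) \<longlonglongrightarrow>
     exp (- real k) / fact k / 2 ^ ((k + 1) choose 2)"
proof -
  define P where "P n = real (n choose k) * (real (nforests (n - k)) * 2 ^ (k * (n - k) +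
      (k choose 2)))" for n
  have ev: "eventually (\<lambda>n. nforests (n - k) > 0 \<and> n \<ge> k) at_top"
    using eventually_compose_filterlim[OF nforests_pos filterlim_minus_const_nat_at_top[of k]]
      eventually_ge_at_top[of k] by (rule eventually_conj)
  have "(\<lambda>n. real (card (apex_sets k {1..n})) / P n) \<longlonglongrightarrow> 1"
  proof (rule LIMSEQ_I)
    fix \<epsilon> :: real assume \<epsilon>: "\<epsilon> > 0"
    \<comment> \<open>With \<open>r\<close> depending on the tolerance only, the number of covered
      graphs is bounded by a power \<open>C ^ (n - k)\<close> with constant base, to which
      \<open>exp_over_nforests\<close> applies.\<close>
    have "(\<lambda>r. real (k * (k + 1)) * (3/4) ^ r) \<longlonglongrightarrow> real (k * (k + 1)) * 0"
      by (intro tendsto_mult tendsto_const LIMSEQ_power_zero) auto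
    then have "eventually (\<lambda>r. real (k * (k + 1)) * (3/4) ^ r < \<epsilon> / 2) at_top"
      by (rule order_tendstoD(2)) (use \<epsilon> in auto)
    then obtain r where r: "real (k * (k + 1)) * (3/4) ^ r < \<epsilon> / 2"
      by (auto simp: eventually_sequentially)
    define C :: real where "C = 2 ^ (2 * ((k + 1) * r) + 1)"
    have "(\<lambda>n. C ^ (n - k) / real (nforests (n - k))) \<longlonglongrightarrow> 0"
      using filterlim_compose[OF exp_over_nforests filterlim_minus_const_nat_at_top, of C k]
      by (simp add: C_def)
    then have "eventually (\<lambda>n. C ^ (n - k) / real (nforests (n - k)) < \<epsilon> / 2) at_top"
      by (rule order_tendstoD(2)) (use \<epsilon> in auto)
    with ev have "eventually (\<lambda>n. norm (real (card (apex_sets k {1..n})) / P n - 1) < \<epsilon>) at_top"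
    proof eventually_elim
      case (elim n)
      define f where "f = real (nforests (n - k))"
      define B where "B = real (n choose k) * 2 ^ (k * (n - k) + (k choose 2))"
      define a where "a = real (card (apex_sets k {1..n}))"
      define R where "R = real (k * (k + 1)) * (3/4) ^ r"
      have pos: "f > 0" "B > 0" using elim by (auto simp: f_def B_def)
      have P: "P n = B * f" by (simp add: P_def B_def f_def)
      have C: "(2::real) ^ ((2 * ((k + 1) * r) + 1) * (n - k)) = C ^ (n - k)"
        by (simp only: C_def power_mult)
      have "a \<le> P n"
        using card_apex_sets_bounds(1)[of "{1..n}" k] by (simp add: P_def a_def)
      moreover have "P n - real (n choose k) * (2 ^ (k * (n - k) + (k choose 2)) * (C ^ (n - k) +
          f * R)) \<le> a"
        using card_apex_sets_bounds(2)[OF finite_atLeastAtMost, of 1 n k r]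
        by (simp only: C P_def a_def f_def R_def card_atLeastAtMost diff_Suc_1)
      ultimately have "a \<le> B * f" "B * f - B * (C ^ (n - k) + f * R) \<le> a"
        unfolding P by (simp_all only: B_def mult.assoc)
      moreover have "B * f - B * (C ^ (n - k) + f * R) = (1 - (C ^ (n - k) / f + R)) * (B * f)"
        using pos by (simp add: field_simps)
      ultimately have "a / (B * f) \<le> 1" "1 - (C ^ (n - k) / f + R) \<le> a / (B * f)"
        using pos by (simp_all add: pos_le_divide_eq)
      then show ?case using r elim unfolding P a_def[symmetric] R_def[symmetric] f_def[symmetric]
          by simp
    qed
    then show "\<exists>no. \<forall>n\<ge>no. norm (real (card (apex_sets k {1..n})) / P n - 1) < \<epsilon>"
      by (simp add: eventually_sequentially)
  qed
  from tendsto_mult[OF this tendsto_divide[OF nforests_ratio_choose[of k] tendsto_const[of "2 ^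
      ((k + 1) choose 2)"]]]
  have "(\<lambda>n. real (card (apex_sets k {1..n})) / P n * (real (n choose k) *
      real (nforests (n - k)) / real (nforests n) / 2 ^ ((k + 1) choose 2)))
     \<longlonglongrightarrow> exp (- real k) / fact k / 2 ^ ((k + 1) choose 2)"
    by simp
  then show ?thesis
  proof (rule Lim_transform_eventually)
    show "\<forall>\<^sub>F n in sequentially. real (card (apex_sets k {1..n})) / P n * (real (n choose k) *
        real (nforests (n - k)) / real (nforests n) / 2 ^ ((k + 1) choose 2)) =
      real (card (apex_sets k {1..n})) / (2 ^ (k * n) * real (nforests n))"
      using ev
    proof eventually_elim
      case (elim n)
      have "(k choose 2) + ((k + 1) choose 2) = k * k"
        by (induction k) (auto simp: numeral_2_eq_2)
      moreover have "k * (n - k) + k * k = k * n"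
        using elim by (simp flip: add_mult_distrib2)
      ultimately have "k * (n - k) + (k choose 2) + ((k + 1) choose 2) = k * n"
        by linarith
      then have "(2::real) ^ (k * n) = 2 ^ (k * (n - k) + (k choose 2)) * 2 ^ ((k + 1) choose 2)"
        by (simp flip: power_add)
      then show ?case using elim by (simp add: P_def field_simps)
    qed
  qed
qed

section \<open>Transfer to labelled graphs\<close>

lemma cas_nth:
  assumes "pre_digraph.cas H u p v" "tail H = fst" "head H = snd" "i < length p"
  shows "fst (p ! i) = (u # map snd p) ! i"
  using assms(1,4)
proof (induction p arbitrary: u i)
  case (Cons e p)
  then show ?case using assms(2,3) by (cases i) (auto simp: pre_digraph.cas.simps)
qed simp

lemma cas_last:
  assumes "pre_digraph.cas H u p v" "tail H = fst" "head H = snd"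
  shows "last (u # map snd p) = v"
  using assms(1)
  by (induction p arbitrary: u) (use assms(2,3) in \<open>auto simp: pre_digraph.cas.simps\<close>)

lemma cas_zip_tl:
  assumes "ys \<noteq> []" "tail H = fst" "head H = snd"
  shows "pre_digraph.cas H (hd ys) (zip ys (tl ys)) (last ys)"
  using assms(1)
proof (induction ys rule: induct_list012)
  case (3 x y zs)
  then show ?case using assms(2,3) by (simp add: pre_digraph.cas.simps)
qed (simp_all add: pre_digraph.cas.simps)

lemma successively_zip_tl:
  "successively P ys \<Longrightarrow> (u, v) \<in> set (zip ys (tl ys)) \<Longrightarrow> P u v"
  by (induction ys rule: induct_list012) auto

context
  fixes H :: "('a, 'a \<times> 'a) pre_digraph" and W :: "'a set" and E :: "'a set set"
  assumes verts: "verts H = W" and arcs: "arcs H = {(u, v). u \<in> W \<and> v \<in> W \<and> u \<noteq> v \<and> {u, v} \<in> E}"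
    and tl_hd: "tail H = fst" "head H = snd" and fin: "finite W"
begin

text \<open>Within the vertex set of a cycle every vertex has its predecessor and its successor as
  neighbours, and these differ because the length is at least three.\<close>

lemma acyc_imp_has_no_cycles:
  assumes "acyc W E"
  shows "has_no_cycles H"
  unfolding has_no_cycles_def
proof
  assume "\<exists>p. pre_digraph.cycle H p \<and> 3 \<le> length p"
  then obtain p u where p: "pre_digraph.awalk H u p u" "distinct (tl (pre_digraph.awalk_verts H u
      p))"
      "3 \<le> length p"
    by (auto simp: pre_digraph.cycle_def)
  \<comment> \<open>Indices are cyclic and \<open>x i\<close> is the head of arc \<open>i\<close>,
    so arc \<open>i + 1\<close> leads from \<open>x i\<close> to \<open>x (i + 1)\<close>.\<close>
  define x where "x i = map snd p ! (i mod length p)" for i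
  let ?L = "length p"
  have L: "?L > 0" using p(3) by linarith
  have cas: "pre_digraph.cas H u p u" and sub: "set p \<subseteq> arcs H"
    using p(1) by (auto simp: pre_digraph.awalk_def)
  have "pre_digraph.awalk_verts H u p = u # map snd p"
    using p(3) tl_hd cas_nth[OF cas tl_hd, of 0]
    by (subst pre_digraph.awalk_verts_conv'[OF cas]) (auto simp: hd_conv_nth)
  with p(2) have dist: "distinct (map snd p)" by simp
  have last: "last (map snd p) = u" using cas_last[OF cas tl_hd] p(3) by (auto split: if_splits)
  have p_nth: "p ! (Suc i mod ?L) = (x i, x (Suc i))" for i
  proof -
    define j where "j = Suc i mod ?L"
    have j: "j < ?L" using L by (auto simp: j_def)
    have "fst (p ! j) = x i"
    proof (cases j)
      case 0
      then have "i mod ?L = ?L - 1" using j unfolding j_def by (auto simp: mod_Suc split: if_splits)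
      moreover have "map snd p \<noteq> []" using L by simp
      ultimately have "x i = u" using last by (simp add: x_def last_conv_nth)
      then show ?thesis using cas_nth[OF cas tl_hd j] 0 by simp
    next
      case (Suc j')
      then have "i mod ?L = j'" using j unfolding j_def by (auto simp: mod_Suc split: if_splits)
      then show ?thesis using cas_nth[OF cas tl_hd j] Suc by (simp add: x_def)
    qed
    moreover have "snd (p ! j) = x (Suc i)" using j by (simp add: x_def j_def)
    ultimately show ?thesis by (simp add: prod_eq_iff j_def)
  qed
  have arc: "x i \<in> W \<and> x (Suc i) \<in> W \<and> x i \<noteq> x (Suc i) \<and> {x i, x (Suc i)} \<in> E" for i
  proof -
    have "p ! (Suc i mod ?L) \<in> set p" using L by (intro nth_mem) auto
    then show ?thesis using sub p_nth[of i] arcs by auto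
  qed
  obtain v where v: "v \<in> range x" "card (nbrs E (range x) v) \<le> 1"
    using assms arc unfolding acyc_def by (metis empty_iff image_subsetI rangeI)
  then obtain i where i: "v = x i" by auto
  have xL: "x (i + ?L) = x i" by (simp add: x_def)
  \<comment> \<open>The predecessor is written with \<open>i + ?L - 1\<close> so that it makes sense
    for \<open>i = 0\<close>.\<close>
  have pred: "x (i + ?L - 1) \<in> nbrs E (range x) v"
  proof -
    have "Suc (i + ?L - 1) = i + ?L" using L by simp
    with arc[of "i + ?L - 1"] xL show ?thesis by (simp only: nbrs_def i) auto
  qed
  have succ: "x (Suc i) \<in> nbrs E (range x) v"
    using arc[of i] by (auto simp: nbrs_def i insert_commute)
  \<comment> \<open>Equality would make \<open>?L\<close> divide \<open>?L - 2\<close>, which is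
    positive and smaller.\<close>
  have "x (i + ?L - 1) \<noteq> x (Suc i)"
  proof
    assume "x (i + ?L - 1) = x (Suc i)"
    then have "(i + ?L - 1) mod ?L = Suc i mod ?L"
      using nth_eq_iff_index_eq[OF dist, of "(i + ?L - 1) mod ?L" "Suc i mod ?L"] L
          by (simp add: x_def)
    then have "?L dvd (i + ?L - 1) - Suc i"
      using p(3) by (subst (asm) mod_eq_dvd_iff_nat) auto
    moreover have "(i + ?L - 1) - Suc i = ?L - 2" by simp
    ultimately show False using p(3) by (auto dest: dvd_imp_le)
  qed
  moreover have "finite (nbrs E (range x) v)"
    using arc fin by (intro finite_nbrs) (auto intro: finite_subset)
  ultimately have "2 \<le> card (nbrs E (range x) v)"
    using pred succ card_mono[of "nbrs E (range x) v" "{x (i + ?L - 1), x (Suc i)}"] by auto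
  with v show False by simp
qed

text \<open>Longest-path argument. If all degrees inside \<open>X\<close> are at least two, a
  longest path in \<open>X\<close> contains all neighbours of its first vertex, and one of them
  beyond the second vertex of the path closes a cycle.\<close>

lemma has_no_cycles_imp_acyc:
  assumes "has_no_cycles H"
  shows "acyc W E"
proof (rule ccontr)
  assume "\<not> acyc W E"
  then obtain X where X: "X \<subseteq> W" "X \<noteq> {}" and X': "\<not> (\<exists>v\<in>X. card (nbrs E X v) \<le> 1)"
    unfolding acyc_def by blast
  define P where "P xs \<longleftrightarrow> distinct xs \<and> set xs \<subseteq> X \<and> successively (\<lambda>u v. u \<noteq> v \<and> {u, v} \<in> E) xs"
      for xs
  have finX: "finite X" using X(1) fin by (rule finite_subset)
  obtain z where "z \<in> X" using X(2) by auto
  then have "P [z]" by (simp add: P_def)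
  moreover have "length xs < Suc (card X)" if "P xs" for xs
    using that finX card_mono[of X "set xs"] by (auto simp: P_def distinct_card)
  ultimately obtain xs where xs: "P xs" "\<And>ys. P ys \<Longrightarrow> length ys \<le> length xs"
    using ex_has_greatest_nat[of P "[z]" length "Suc (card X)"] by blast
  have "length xs \<ge> 1" using xs(2)[OF \<open>P [z]\<close>] by simp
  then obtain a xs' where xs': "xs = a # xs'" by (cases xs) auto
  have a: "a \<in> X" using xs(1) by (simp add: P_def xs')
  have nb: "nbrs E X a \<subseteq> set xs'"
  proof
    fix b assume b: "b \<in> nbrs E X a"
    have "\<not> P (b # xs)" using xs(2)[of "b # xs"] by auto
    moreover have "successively (\<lambda>u v. u \<noteq> v \<and> {u, v} \<in> E) (b # xs)"
      using b xs(1) by (auto simp: P_def xs' nbrs_def)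
    ultimately show "b \<in> set xs'" using b xs(1) by (auto simp: P_def xs' nbrs_def)
  qed
  \<comment> \<open>Position 0 of \<open>xs'\<close> is the second vertex of the path. A neighbour
    at position \<open>i \<ge> 1\<close> gives a cycle of length \<open>i + 2\<close>, hence at
    least three.\<close>
  have "\<exists>i. i \<ge> 1 \<and> i < length xs' \<and> xs' ! i \<in> nbrs E X a"
  proof (rule ccontr)
    assume *: "\<not> ?thesis"
    have "nbrs E X a \<subseteq> {xs' ! 0}"
    proof
      fix b assume "b \<in> nbrs E X a"
      moreover from this obtain i where "i < length xs'" "xs' ! i = b"
        using nb by (meson in_set_conv_nth subset_eq)
      ultimately show "b \<in> {xs' ! 0}" using * by (cases i) auto
    qed
    then have "card (nbrs E X a) \<le> 1" using card_mono[of "{xs' ! 0}"] by fastforce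
    then show False using X' a by blast
  qed
  then obtain i where i: "i \<ge> 1" "i < length xs'" "xs' ! i \<in> nbrs E X a" by auto
  define ys where "ys = a # take (Suc i) xs'"
  have ys: "ys = take (Suc (Suc i)) xs" by (simp add: ys_def xs')
  have lys: "length ys = Suc (Suc i)" "last ys = xs' ! i"
    using i by (simp_all add: ys_def take_Suc_conv_app_nth)
  have "successively (\<lambda>u v. u \<noteq> v \<and> {u, v} \<in> E) ys"
  proof -
    have "successively (\<lambda>u v. u \<noteq> v \<and> {u, v} \<in> E) (take (Suc (Suc i)) xs @ drop (Suc (Suc i)) xs)"
      using xs(1) unfolding append_take_drop_id by (simp only: P_def)
    then show ?thesis unfolding ys successively_append_iff by blast
  qed
  then have succ: "successively (\<lambda>u v. u \<noteq> v \<and> {u, v} \<in> E) (ys @ [a])"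
    using i(3) lys by (auto simp: successively_append_iff nbrs_def)
  define q where "q = zip (ys @ [a]) (tl (ys @ [a]))"
  have tl: "tl (ys @ [a]) = take (Suc i) xs' @ [a]" by (simp add: ys_def)
  have lq: "length q = Suc (Suc i)" using lys tl i by (simp add: q_def)
  have cas: "pre_digraph.cas H a q a"
    using cas_zip_tl[of "ys @ [a]" H] tl_hd by (simp add: q_def ys_def)
  have setys: "set (ys @ [a]) \<subseteq> W"
    using xs(1) X(1) a set_take_subset[of "Suc (Suc i)" xs] by (auto simp: P_def ys)
  have "set q \<subseteq> arcs H"
  proof
    fix e assume e: "e \<in> set q"
    obtain u v where uv: "e = (u, v)" by (cases e)
    have "u \<noteq> v \<and> {u, v} \<in> E"
      using successively_zip_tl[OF succ, of u v] e uv unfolding q_def by simp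
    moreover have "u \<in> set (ys @ [a])"
      using e unfolding uv q_def by (rule set_zip_leftD)
    moreover have "v \<in> set (tl (ys @ [a]))"
      using e unfolding uv q_def by (rule set_zip_rightD)
    then have "v \<in> set (ys @ [a])" unfolding tl by (auto simp: ys_def)
    ultimately show "e \<in> arcs H" using setys arcs uv by auto
  qed
  then have "pre_digraph.awalk H a q a"
    using cas a X(1) verts by (auto simp: pre_digraph.awalk_def)
  moreover have "distinct (tl (pre_digraph.awalk_verts H a q))"
  proof -
    have "map snd q = take (Suc i) xs' @ [a]"
      unfolding q_def map_snd_zip_take by (simp flip: tl)
    moreover have "tl (pre_digraph.awalk_verts H a q) = map snd q"
      using lq tl_hd by (subst pre_digraph.awalk_verts_conv'[OF cas]) auto
    moreover have "distinct (take (Suc i) xs' @ [a])"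
      using xs(1) by (auto simp: P_def xs' dest: in_set_takeD)
    ultimately show ?thesis by simp
  qed
  moreover have "3 \<le> length q" "q \<noteq> []" using lq i by auto
  ultimately show False
    using assms by (auto simp: has_no_cycles_def pre_digraph.cycle_def)
qed

lemma has_no_cycles_iff_acyc: "has_no_cycles H \<longleftrightarrow> acyc W E"
  using acyc_imp_has_no_cycles has_no_cycles_imp_acyc by blast

end

section \<open>Edge sets as labelled graphs\<close>

definition graph_of :: "'a set \<Rightarrow> 'a set set \<Rightarrow> 'a pair_pre_digraph" where
  "graph_of V E = \<lparr>pverts = V, parcs = {(u, v). {u, v} \<in> E}\<rparr>"

lemma pair_graph_graph_of:
  assumes "finite V" "E \<subseteq> pairs V"
  shows "pair_graph (graph_of V E)"
proof -
  have arc: "u \<in> V \<and> v \<in> V \<and> u \<noteq> v" if "{u, v} \<in> E" for u v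
    using that assms by (metis doubleton_in_pairs subsetD)
  then have "parcs (graph_of V E) \<subseteq> V \<times> V" by (auto simp: graph_of_def)
  then have "finite (parcs (graph_of V E))"
    using assms by (meson finite_SigmaI finite_subset)
  moreover have "symmetric (with_proj (graph_of V E))"
    by (auto simp: symmetric_def graph_of_def sym_def insert_commute)
  ultimately show ?thesis
    using assms arc by unfold_locales (auto simp: graph_of_def)
qed

lemma inj_on_graph_of: "inj_on (graph_of V) (Pow (pairs V))"
proof (rule inj_onI)
  fix E F assume EF: "E \<in> Pow (pairs V)" "F \<in> Pow (pairs V)" "graph_of V E = graph_of V F"
  then have eq: "{u, v} \<in> E \<longleftrightarrow> {u, v} \<in> F" for u v by (auto simp: graph_of_def set_eq_iff)
  have "e \<in> E \<longleftrightarrow> e \<in> F" if "e \<in> pairs V" for e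
    using that eq by (elim pairs_cases) simp
  then show "E = F" using EF(1,2) by blast
qed

lemma pair_graph_imp_graph_of:
  assumes "pair_graph G"
  obtains E where "E \<subseteq> pairs (pverts G)" "G = graph_of (pverts G) E"
proof
  interpret pair_graph G by fact
  let ?E = "(\<lambda>(u, v). {u, v}) ` parcs G"
  show "?E \<subseteq> pairs (pverts G)"
    using in_arcsD1 in_arcsD2 pair_no_loops by fastforce
  have "(u, v) \<in> parcs G" if "(v, u) \<in> parcs G" for u v
    using pair_sym_arcs that by (auto simp: symmetric_def sym_def)
  then have "{(u, v). {u, v} \<in> ?E} = parcs G" by (auto simp: doubleton_eq_iff)
  then show "G = graph_of (pverts G) ?E" by (cases G) (simp add: graph_of_def)
qed

lemma blocker_graph_of:
  assumes "finite V" "E \<subseteq> pairs V"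
  shows "blocker (with_proj (graph_of V E)) S \<longleftrightarrow> S \<subseteq> V \<and> acyc (V - S) E"
proof -
  have "has_no_cycles (delete_verts (with_proj (graph_of V E)) S) \<longleftrightarrow> acyc (V - S) E"
  proof (rule has_no_cycles_iff_acyc)
    have "u \<noteq> v" if "{u, v} \<in> E" for u v
      using that assms by (metis doubleton_in_pairs subsetD)
    then show "arcs (delete_verts (with_proj (graph_of V E)) S) =
        {(u, v). u \<in> V - S \<and> v \<in> V - S \<and> u \<noteq> v \<and> {u, v} \<in> E}"
      by (auto simp: delete_verts_def graph_of_def)
  qed (use assms in \<open>auto simp: delete_verts_def graph_of_def\<close>)
  then show ?thesis by (simp add: blocker_def graph_of_def)
qed

lemma labelled_apex_forests_eq:
  assumes "k \<le> n"
  shows "labelled (apex_forests k) n = graph_of {1..n} ` apex_sets k {1..n}"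
proof (intro set_eqI iffI)
  fix G assume "G \<in> labelled (apex_forests k) n"
  then obtain S where G: "pair_graph G" "pverts G = {1..n}" "blocker (with_proj G) S" "card S \<le> k"
    by (auto simp: labelled_def apex_forests_def)
  then obtain E where E: "E \<subseteq> pairs {1..n}" "G = graph_of {1..n} E"
    by (metis pair_graph_imp_graph_of)
  with G have S: "S \<subseteq> {1..n}" "acyc ({1..n} - S) E" by (auto simp: blocker_graph_of)
  obtain T where T: "S \<subseteq> T" "T \<subseteq> {1..n}" "card T = k"
    using exists_subset_between[of S k "{1..n}"] G(4) S(1) assms by auto
  then have "acyc ({1..n} - T) E" using S(2) by (auto elim: acyc_subset)
  then show "G \<in> graph_of {1..n} ` apex_sets k {1..n}"
    using E T by (auto simp: apex_sets_def near_forests_def)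
next
  fix G assume "G \<in> graph_of {1..n} ` apex_sets k {1..n}"
  then obtain E S where E: "G = graph_of {1..n} E" "E \<subseteq> pairs {1..n}" "S \<subseteq> {1..n}" "card S =
      k" "acyc ({1..n} - S) E"
    by (auto simp: apex_sets_def near_forests_def)
  then have "blocker (with_proj G) S" by (simp add: blocker_graph_of)
  moreover have "pverts G = {1..n}" using E by (simp add: graph_of_def)
  ultimately show "G \<in> labelled (apex_forests k) n"
    using E pair_graph_graph_of[of "{1..n}" E] by (auto simp: labelled_def apex_forests_def)
qed

lemma card_labelled_apex_forests:
  assumes "k \<le> n"
  shows "card (labelled (apex_forests k) n) = card (apex_sets k {1..n})"
  unfolding labelled_apex_forests_eq[OF assms]
  by (rule card_image, rule inj_on_subset[OF inj_on_graph_of]) (auto simp: apex_sets_def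
      near_forests_def)

text \<open>Forests are the case k = 0, where the empty set is the only candidate for a
  blocker.\<close>

lemma card_labelled_forests: "card (labelled forests n) = nforests n"
proof -
  have "{S. S \<subseteq> {1..n} \<and> card S = 0} = {{}}" by (auto simp: finite_subset)
  then have "apex_sets 0 {1..n} = forest_on {1..n}"
    by (simp add: apex_sets_def near_forests_def forest_on_def)
  then show ?thesis using card_labelled_apex_forests[of 0 n]
      by (simp add: apex_forests_0 nforests_def)
qed

theorem theorem1p2:
  fixes k :: nat
  assumes "k \<ge> 1"
  defines "c \<equiv> inverse (2 ^ ((k + 1) choose 2) * exp (real k) * fact k) :: real"
  shows "(\<lambda>n. real (card (labelled (apex_forests k) n)))
           \<sim>[at_top] (\<lambda>n. c * 2 ^ (k * n) * real (card (labelled forests n)))"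
proof (rule asymp_equivI')
  have c: "c > 0" "exp (- real k) / fact k / 2 ^ ((k + 1) choose 2) = c"
    by (simp_all add: c_def exp_minus field_simps)
  from tendsto_divide[OF card_apex_sets_asymptotics[of k, unfolded c(2)] tendsto_const[of c]] c(1)
  have "(\<lambda>n. real (card (apex_sets k {1..n})) / (2 ^ (k * n) * real (nforests n)) / c) \<longlonglongrightarrow> 1"
    by simp
  then show "(\<lambda>n. real (card (labelled (apex_forests k) n)) / (c * 2 ^ (k * n) *
      real (card (labelled forests n)))) \<longlonglongrightarrow> 1"
  proof (rule Lim_transform_eventually)
    show "\<forall>\<^sub>F n in sequentially. real (card (apex_sets k {1..n})) / (2 ^ (k * n) *
        real (nforests n)) / c =
      real (card (labelled (apex_forests k) n)) / (c * 2 ^ (k * n) *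
          real (card (labelled forests n)))"
      \<comment> \<open>For \<open>n < k\<close> there are no \<open>k\<close>-subsets and
        \<open>apex_sets\<close> is empty, so the two counts agree only from \<open>n = k\<close>
        on.\<close>
      using eventually_ge_at_top[of k]
      by eventually_elim (simp add: card_labelled_apex_forests card_labelled_forests mult_ac)
  qed
qed

end
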